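(* Assume that $\dim_{\mathbb{K}}\mathbf{f}=3$. Let $F_1\in\mathbb{K}[t,v,w,x,y,z]$ be an irreducible factor of $\mathrm{Res}_{su}(\mathbf{x}\mathbf{B},\mathbf{x}\mathbf{C})$ that follows $\mathbf{h}$. Then $\mathrm{Res}_{tv}(\mathbf{x}\mathbf{A},F_1)$ is a nonzero polynomial in $\mathbb{K}[w,x,y,z]$ and factors as $\mathrm{Res}_{tv}(\mathbf{x}\mathbf{A},F_1)=EF$ with $E,F\in\mathbb{K}[w,x,y,z]$, where $F$ is the implicit equation of $X_{\mathbf{h}}$.
   Context: $\mathbb{K}$ is an algebraically closed field of characteristic zero and $R=\mathbb{K}[s,u,t,v]$. Let $\mathbf{f}=(f_0,f_1,f_2,f_3)$ with $f_i\in\mathbb{K}[s,u]$ homogeneous of degree $m\ge 1$, and $\mathbf{g}=(g_0,g_1,g_2,g_3)$ with $g_i\in\mathbb{K}[t,v]$ homogeneous of degree $n\geq 1$, where $\gcd(f_0,\dots,f_3)=1=\gcd(g_0,\dots,g_3)$ and $f_0\neq 0$, $g_0\ne 0$. Write $\dim_{\mathbb{K}}\mathbf{f}$ for the dimension of the $\mathbb{K}$-vector space spanned by $f_0,f_1,f_2,f_3$. Let $\mathbf{h}=(h_0,h_1,h_2,h_3)$ with $h_i=f_0g_i+f_ig_0\in R$; it defines a rational map $\mathbb{P}^1\times\mathbb{P}^1\dashrightarrow\mathbb{P}^3$ with image $X_{\mathbf{h}}$, which is assumed to be a surface (its Zariski closure has dimension 2). The implicit equation of $X_{\mathbf{h}}$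 is the irreducible homogeneous polynomial in $\mathbb{K}[w,x,y,z]$ (unique up to unit) whose zero locus in $\mathbb{P}^3$ is the Zariski closure of $X_{\mathbf{h}}$. The module $\mathrm{syz}(\mathbf{f})$ of syzygies of $(f_0,f_1,f_2,f_3)$ over $\mathbb{K}[s,u]$ is graded free of rank 3; let $\mathbf{a},\mathbf{b},\mathbf{c}$ (column vectors of length 4) be a homogeneous basis, with entries homogeneous of degrees $\mu_1\le\mu_2\le\mu_3$ respectively, $\mu_1+\mu_2+\mu_3=m$. Let $$N_{\mathbf{g}}=\begin{bmatrix}\frac{g_0}{2}&-\frac{g_1}{2}&-\frac{g_2}{2}&-\frac{g_3}{2}\\0&g_0&0&0\\0&0&g_0&0\\0&0&0&g_0\end{bmatrix}.$$ For a vector, $\gcd(\cdot)$ is the greatest common divisor in $R$ of its entries. Set $\mathbf{A}=\frac{N_{\mathbf{g}}\mathbf{a}}{\gcd(N_{\mathbf{g}}\mathbf{a})}$, $\mathbf{B}=\frac{N_{\mathbf{g}}\mathbf{b}}{\gcd(N_{\mathbf{g}}\mathbf{b})}$, $\mathbf{C}=\frac{N_{\mathbf{g}}\mathbf{c}}{\gcd(N_{\mathbf{g}}\mathbf{c})}$. Let $\mathbf{x}=[w,x,y,z]$ be coordinates on $\mathbb{P}^3$; then $\mathbf{x}\mathbf{A},\mathbf{x}\mathbf{B},\mathbf{x}\mathbf{C}\in R[w,x,y,z]$ are homogeneous in $s,u$ of degrees $\mu_1,\mu_2,\mu_3$. When $\dim_{\mathbb{K}}\mathbf{f}=3$ one has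 $\mu_1=0$, so $\mathbf{x}\mathbf{A}\in\mathbb{K}[t,v,w,x,y,z]$. A polynomial $P\in R[w,x,y,z]$ homogeneous in $w,x,y,z$ (a moving surface) follows $\mathbf{h}$ if $P(h_0,h_1,h_2,h_3)=0$ in $R$. For polynomials $p,q$ homogeneous of degrees $d,e$ in two variables over a UFD, $\mathrm{Res}(p,q)$ is the determinant of the homogeneous Sylvester $(d+e)\times(d+e)$ matrix ($e$ shifted rows of coefficients of $p$, then $d$ shifted rows of coefficients of $q$; the empty determinant is $1$). $\mathrm{Res}_{su}$ is taken with respect to $s,u$ (coefficients in $\mathbb{K}[t,v,w,x,y,z]$), and $\mathrm{Res}_{tv}$ with respect to $t,v$ (coefficients in $\mathbb{K}[w,x,y,z]$). *)

theory Defs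
  imports "Subresultants.Resultant_Prelim" "HOL-Library.Extended_Nat"
begin

text \<open>
  Polynomial rings are iterated univariate ones; in \<open>'c poly2\<close> the first variable is
  the inner one. The rings used are
    \<open>'a poly2\<close> for \<open>K[s,u]\<close>, \<open>K[t,v]\<close>;
    \<open>'a poly4\<close> for \<open>K[w,x,y,z] = K[w,x][y,z]\<close>;
    \<open>'a poly4\<close> also for \<open>R = K[t,v][s,u]\<close> (so \<open>t,v\<close> are the inner variables);
    \<open>'a poly4 poly2\<close> for \<open>K[w,x,y,z][t,v]\<close>;
    \<open>'a poly4 poly4\<close> for \<open>R[w,x,y,z]\<close>, written as \<open>K[w,x,y,z][t,v][s,u]\<close>.
  Vectors of length 4 are indexed by 0, 1, 2, 3.
\<close>

type_synonym 'c poly2 = "'c poly poly"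
type_synonym 'c poly4 = "'c poly2 poly2"

definition const2 :: "'c::zero \<Rightarrow> 'c poly2" where
  "const2 c = [:[:c:]:]"

definition const4 :: "'c::zero \<Rightarrow> 'c poly4" where
  "const4 c = const2 (const2 c)"

definition var1 :: "'c::comm_ring_1 poly2" where
  "var1 = [:[:0, 1:]:]"

definition var2 :: "'c::comm_ring_1 poly2" where
  "var2 = [:0, 1:]"

definition coeff2 :: "'c::zero poly2 \<Rightarrow> nat \<Rightarrow> nat \<Rightarrow> 'c" where
  "coeff2 p i j = coeff (coeff p j) i"

definition coeff4 :: "'c::zero poly4 \<Rightarrow> nat \<Rightarrow> nat \<Rightarrow> nat \<Rightarrow> nat \<Rightarrow> 'c" where
  "coeff4 p i j k l = coeff2 (coeff2 p k l) i j"

definition map_poly2 :: "('c::zero \<Rightarrow> 'd::zero) \<Rightarrow> 'c poly2 \<Rightarrow> 'd poly2" where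
  "map_poly2 \<phi> = map_poly (map_poly \<phi>)"

text \<open>Evaluation, the coefficients being mapped by \<open>\<phi>\<close>.\<close>

definition eval2 :: "('c::zero \<Rightarrow> 'r::comm_ring_1) \<Rightarrow> 'c poly2 \<Rightarrow> 'r \<Rightarrow> 'r \<Rightarrow> 'r" where
  "eval2 \<phi> p x y = eval_poly (\<lambda>q. eval_poly \<phi> q x) p y"

definition eval4 ::
  "('c::zero \<Rightarrow> 'r::comm_ring_1) \<Rightarrow> 'c poly4 \<Rightarrow> 'r \<Rightarrow> 'r \<Rightarrow> 'r \<Rightarrow> 'r \<Rightarrow> 'r" where
  "eval4 \<phi> p x1 x2 x3 x4 = eval2 (\<lambda>q. eval2 \<phi> q x1 x2) p x3 x4"

definition eval4_vec :: "('c::zero \<Rightarrow> 'r::comm_ring_1) \<Rightarrow> 'c poly4 \<Rightarrow> 'r vec \<Rightarrow> 'r" where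
  "eval4_vec \<phi> p x = eval4 \<phi> p (x $ 0) (x $ 1) (x $ 2) (x $ 3)"

definition homogeneous2 :: "nat \<Rightarrow> 'c::zero poly2 \<Rightarrow> bool" where
  "homogeneous2 d p \<longleftrightarrow> (\<forall>i j. coeff2 p i j \<noteq> 0 \<longrightarrow> i + j = d)"

definition homogeneous4 :: "nat \<Rightarrow> 'c::zero poly4 \<Rightarrow> bool" where
  "homogeneous4 d p \<longleftrightarrow> (\<forall>i j k l. coeff4 p i j k l \<noteq> 0 \<longrightarrow> i + j + k + l = d)"

text \<open>Total degree in the two outer variables; the zero polynomial has degree 0.\<close>

definition tdegree2 :: "'c::zero poly2 \<Rightarrow> nat" where
  "tdegree2 p = Max (insert 0 {i + j | i j. coeff2 p i j \<noteq> 0})"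

text \<open>
  For homogeneous \<open>p\<close>, setting the second variable to 1 preserves the list of
  coefficients, so this is the determinant of the homogeneous Sylvester matrix. Its size is
  given by the total degrees of \<open>p\<close> and \<open>q\<close>, not by the degrees of the dehomogenizations.
\<close>

definition hom_resultant :: "'c::comm_ring_1 poly2 \<Rightarrow> 'c poly2 \<Rightarrow> 'c" where
  "hom_resultant p q =
     det (sylvester_mat_sub (tdegree2 p) (tdegree2 q) (poly p 1) (poly q 1))"

definition is_gcd :: "'r::comm_ring_1 \<Rightarrow> 'r set \<Rightarrow> bool" where
  "is_gcd d P \<longleftrightarrow> (\<forall>p\<in>P. d dvd p) \<and> (\<forall>e. (\<forall>p\<in>P. e dvd p) \<longrightarrow> e dvd d)"

text \<open>\<open>V = v / gcd(v)\<close>, determined by \<open>v\<close> up to a unit.\<close>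

definition is_primitive_part :: "'r::comm_ring_1 vec \<Rightarrow> 'r vec \<Rightarrow> bool" where
  "is_primitive_part V v \<longleftrightarrow> (\<exists>d. is_gcd d (set\<^sub>v v) \<and> v = d \<cdot>\<^sub>v V)"

definition dim_span :: "'a::field poly2 vec \<Rightarrow> nat" where
  "dim_span f = vector_space.dim (\<lambda>c p. const2 c * p) (set\<^sub>v f)"

definition syz :: "'r::comm_ring_1 vec \<Rightarrow> 'r vec set" where
  "syz f = {p \<in> carrier_vec (dim_vec f). p \<bullet> f = 0}"

definition is_syz_basis ::
  "'r::comm_ring_1 vec \<Rightarrow> 'r vec \<Rightarrow> 'r vec \<Rightarrow> 'r vec \<Rightarrow> bool" where
  "is_syz_basis f a b c \<longleftrightarrow> a \<in> syz f \<and> b \<in> syz f \<and> c \<in> syz f \<and>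
     (\<forall>p\<in>syz f. \<exists>!(\<alpha>, \<beta>, \<gamma>). p = \<alpha> \<cdot>\<^sub>v a + \<beta> \<cdot>\<^sub>v b + \<gamma> \<cdot>\<^sub>v c)"

text \<open>The inclusions of \<open>K[s,u]\<close> and \<open>K[t,v]\<close> into \<open>R = K[t,v][s,u]\<close>.\<close>

definition of_su :: "'a::zero poly2 \<Rightarrow> 'a poly4" where
  "of_su p = map_poly2 const2 p"

definition of_tv :: "'a::zero poly2 \<Rightarrow> 'a poly4" where
  "of_tv q = const2 q"

definition h_param :: "'a::field poly2 vec \<Rightarrow> 'a poly2 vec \<Rightarrow> 'a poly4 vec" where
  "h_param f g =
     vec 4 (\<lambda>i. of_su (f $ 0) * of_tv (g $ i) + of_su (f $ i) * of_tv (g $ 0))"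

definition N_mat :: "'a::field poly2 vec \<Rightarrow> 'a poly4 mat" where
  "N_mat g =
     (let G = (\<lambda>i. of_tv (g $ i)); r = const4 (1/2) in
      mat_of_rows_list 4
        [[r * G 0, - (r * G 1), - (r * G 2), - (r * G 3)],
         [0, G 0, 0, 0],
         [0, 0, G 0, 0],
         [0, 0, 0, G 0]])"

definition wxyz :: "'a::comm_ring_1 poly4 vec" where
  "wxyz = vec_of_list [const2 var1, const2 var2, var1, var2]"

definition moving_plane :: "'a::comm_ring_1 poly4 vec \<Rightarrow> 'a poly4 poly4" where
  "moving_plane A = map_vec const4 wxyz \<bullet> map_vec (map_poly2 (map_poly2 const4)) A"

text \<open>
  The last four arguments are \<open>t, v, s, u\<close> as elements of \<open>R\<close>: the substitution replaces
  \<open>w, x, y, z\<close> by the entries of \<open>h\<close> and leaves \<open>s, u, t, v\<close> unchanged.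
\<close>

definition subst_wxyz :: "'a::comm_ring_1 poly4 poly4 \<Rightarrow> 'a poly4 vec \<Rightarrow> 'a poly4" where
  "subst_wxyz P h =
     eval4 (\<lambda>q. eval4_vec const4 q h) P (const2 var1) (const2 var2) var1 var2"

definition follows :: "'a::comm_ring_1 poly4 poly4 \<Rightarrow> 'a poly4 vec \<Rightarrow> bool" where
  "follows P h \<longleftrightarrow>
     (\<exists>d. \<forall>i j k l. homogeneous4 d (coeff4 P i j k l)) \<and> subst_wxyz P h = 0"

text \<open>A point of \<open>P\<^sup>3\<close> is the set of all its homogeneous coordinate vectors.\<close>

definition proj_point :: "'a::field vec \<Rightarrow> 'a vec set" where
  "proj_point x = {c \<cdot>\<^sub>v x | c. c \<noteq> 0}"

definition proj_zeros :: "'a::field poly4 set \<Rightarrow> 'a vec set set" where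
  "proj_zeros S =
     {proj_point x | x. x \<in> carrier_vec 4 \<and> x \<noteq> 0\<^sub>v 4 \<and> (\<forall>G\<in>S. eval4_vec id G x = 0)}"

definition zariski_closed :: "'a::field vec set set \<Rightarrow> bool" where
  "zariski_closed Z \<longleftrightarrow> (\<exists>S. (\<forall>G\<in>S. \<exists>d. homogeneous4 d G) \<and> Z = proj_zeros S)"

definition zariski_closure :: "'a::field vec set set \<Rightarrow> 'a vec set set" where
  "zariski_closure X = \<Inter>{Z. zariski_closed Z \<and> X \<subseteq> Z}"

definition zariski_irreducible :: "'a::field vec set set \<Rightarrow> bool" where
  "zariski_irreducible Z \<longleftrightarrow> Z \<noteq> {} \<and>
     (\<forall>C D. zariski_closed C \<and> zariski_closed D \<and> Z \<subseteq> C \<union> D \<longrightarrow> Z \<subseteq> C \<or> Z \<subseteq> D)"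

text \<open>Krull dimension of a Zariski closed set.\<close>

definition zariski_dim :: "'a::field vec set set \<Rightarrow> enat" where
  "zariski_dim X = Sup {enat n | n. \<exists>Z :: nat \<Rightarrow> 'a vec set set.
     (\<forall>i\<le>n. zariski_closed (Z i) \<and> zariski_irreducible (Z i) \<and> Z i \<subseteq> X) \<and>
     (\<forall>i<n. Z i \<subset> Z (Suc i))}"

definition image_surface :: "'a::field poly4 vec \<Rightarrow> 'a vec set set" where
  "image_surface h =
     {proj_point x | x s u t v. (s, u) \<noteq> (0, 0) \<and> (t, v) \<noteq> (0, 0) \<and>
        x = map_vec (\<lambda>p. eval4 id p t v s u) h \<and> x \<noteq> 0\<^sub>v 4}"

definition implicit_equation :: "'a::field poly4 \<Rightarrow> 'a poly4 vec \<Rightarrow> bool" where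
  "implicit_equation F h \<longleftrightarrow> irreducible F \<and> (\<exists>d. homogeneous4 d F) \<and>
     proj_zeros {F} = zariski_closure (image_surface h)"

end

theory Submission
  imports Defs "Berlekamp_Zassenhaus.Unique_Factorization_Poly"
begin

hide_const (open) dvd_class.is_gcd

text \<open>
  Following \<open>h\<close> and being homogeneous in \<open>w, x, y, z\<close>, the resultant of \<open>x A\<close> and \<open>F\<^sub>1\<close> vanishes on
  the surface, so it is divisible by the irreducible \<open>F\<close> (Nullstellensatz for hypersurfaces). It is
  nonzero unless the homogeneous polynomials \<open>x A\<close> and \<open>F\<^sub>1\<close> have a common factor, that is, unless
  \<open>F\<^sub>1\<close> divides \<open>x A\<close>. To exclude this, specialize \<open>(t, v)\<close> so that \<open>g\<^sub>0(t, v) \<noteq> 0\<close>. Then \<open>N\<close> is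
  invertible, and a point of the plane \<open>x A = 0\<close> at which \<open>Res(x B, x C)\<close> vanishes corresponds to
  a vector orthogonal to \<open>a, b, c\<close> at some \<open>(s, u)\<close>, that is, proportional to \<open>f(s, u)\<close>. The
  two-dimensional cone of these vectors does not fill the three-dimensional space orthogonal to the
  constant syzygy \<open>a\<close>.
\<close>

text \<open>The matrix N comes from the identity h N = g_0^2 f for row vectors; the 1/2 in its
  corner compensates h_0 = 2 f_0 g_0. So N turns every syzygy of f into one of h, which is why x A
  vanishes on the surface. Two steps are less direct than they sound. If x A and F_1 are both free
  of t, v, their Sylvester matrix is empty with determinant 1, and a common zero says nothing about
  it. In that case F divides both, the irreducible F_1 is an associate of F, and so F_1 divides x A,
  which is excluded. Moreover, F_1 is given only as a factor of a resultant, while homogeneous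
  Sylvester matrices concern forms; hence the treatment of gradings, by which factors of forms are
  forms. That F_1 follows h also enters the nonvanishing: h is zero at s = u = 0, so F_1 vanishes at
  the origin of (w, x, y, z)-space. This separates F_1 from possible factors in t, v alone.\<close>

section \<open>Ring homomorphisms and evaluation of univariate polynomials\<close>

lemma comm_ring_homI:
  fixes \<phi> :: "'r::comm_ring_1 \<Rightarrow> 's::comm_ring_1"
  assumes "\<And>x y. \<phi> (x + y) = \<phi> x + \<phi> y" "\<And>x y. \<phi> (x * y) = \<phi> x * \<phi> y" "\<phi> 1 = 1"
  shows "comm_ring_hom \<phi>"
proof -
  have "\<phi> 0 + \<phi> 0 = \<phi> 0" using assms(1)[of 0 0] by simp
  then have "\<phi> 0 = 0" by simp
  with assms show ?thesis by unfold_locales auto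
qed

lemma eval_poly_pCons:
  assumes "comm_ring_hom \<phi>"
  shows "eval_poly \<phi> (pCons a p) x = \<phi> a + x * eval_poly \<phi> p x"
proof -
  interpret comm_ring_hom \<phi> by fact
  show ?thesis by (simp add: eval_poly_def map_poly_pCons_hom)
qed

lemma comm_ring_hom_map_poly:
  fixes \<phi> :: "'r::comm_ring_1 \<Rightarrow> 's::comm_ring_1"
  assumes "comm_ring_hom \<phi>"
  shows "comm_ring_hom (map_poly \<phi>)"
proof (rule comm_ring_homI)
  interpret comm_ring_hom \<phi> by fact
  show add: "map_poly \<phi> (p + q) = map_poly \<phi> p + map_poly \<phi> q" for p q
    by (simp add: map_poly_hom_add)
  show "map_poly \<phi> (p * q) = map_poly \<phi> p * map_poly \<phi> q" for p q
    by (rule poly_eqI) (simp add: coeff_mult hom_sum hom_mult)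
  show "map_poly \<phi> 1 = 1" by simp
qed

lemma eval_poly_simps:
  assumes "comm_ring_hom \<phi>"
  shows "eval_poly \<phi> 0 x = 0" "eval_poly \<phi> 1 x = 1"
    "eval_poly \<phi> (p + q) x = eval_poly \<phi> p x + eval_poly \<phi> q x"
    "eval_poly \<phi> (p * q) x = eval_poly \<phi> p x * eval_poly \<phi> q x"
proof -
  interpret comm_ring_hom "map_poly \<phi>" by (rule comm_ring_hom_map_poly[OF assms])
  show "eval_poly \<phi> 0 x = 0" "eval_poly \<phi> 1 x = 1"
    "eval_poly \<phi> (p + q) x = eval_poly \<phi> p x + eval_poly \<phi> q x"
    "eval_poly \<phi> (p * q) x = eval_poly \<phi> p x * eval_poly \<phi> q x"
    by (simp_all add: eval_poly_def hom_add hom_mult)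
qed

lemma comm_ring_hom_eval_poly:
  "comm_ring_hom \<phi> \<Longrightarrow> comm_ring_hom (\<lambda>p. eval_poly \<phi> p x)"
  by (rule comm_ring_homI) (simp_all add: eval_poly_simps)

lemma comm_ring_hom_compose:
  fixes \<phi> :: "'r::comm_ring_1 \<Rightarrow> 's::comm_ring_1" and \<theta> :: "'s \<Rightarrow> 't::comm_ring_1"
  assumes "comm_ring_hom \<phi>" "comm_ring_hom \<theta>"
  shows "comm_ring_hom (\<lambda>x. \<theta> (\<phi> x))"
proof -
  interpret a: comm_ring_hom \<phi> by fact
  interpret b: comm_ring_hom \<theta> by fact
  show ?thesis by (rule comm_ring_homI) (simp_all add: a.hom_add a.hom_mult b.hom_add b.hom_mult)
qed

lemma comm_ring_hom_const_poly: "comm_ring_hom (\<lambda>a::'r::comm_ring_1. [:a:])"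
  by (rule comm_ring_homI) auto

section \<open>Gradings\<close>

text \<open>
  A grading is encoded as the ring homomorphism that multiplies the component of degree \<open>d\<close>
  by the \<open>d\<close>-th power of a new variable. Being homogeneous is then stable under factors,
  because the factors of a monomial are monomials.
\<close>

locale grading = comm_ring_hom H for H :: "'r::comm_ring_1 \<Rightarrow> 'r poly" +
  assumes poly_1: "poly (H p) 1 = p"

definition homog :: "('r::comm_ring_1 \<Rightarrow> 'r poly) \<Rightarrow> nat \<Rightarrow> 'r \<Rightarrow> bool" where
  "homog H d p \<longleftrightarrow> H p = monom p d"

text \<open>The grading of the polynomial ring in which the new variable has degree \<open>w\<close>.\<close>

definition lift_grading :: "nat \<Rightarrow> ('r::comm_ring_1 \<Rightarrow> 'r poly) \<Rightarrow> 'r poly \<Rightarrow> 'r poly poly" where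
  "lift_grading w H p = eval_poly (\<lambda>c. map_poly (\<lambda>a. [:a:]) (H c)) p (monom [:0, 1:] w)"

definition triv_grading :: "'r::comm_ring_1 \<Rightarrow> 'r poly" where
  "triv_grading c = [:c:]"

lemma grading_triv: "grading triv_grading"
  using comm_ring_hom_const_poly by (simp add: grading_def grading_axioms_def triv_grading_def[abs_def])

lemma homog_triv: "homog triv_grading d c \<longleftrightarrow> c = 0 \<or> d = 0"
proof -
  have "[:c:] = monom c d \<longleftrightarrow> c = 0 \<or> d = 0"
    by (metis coeff_monom coeff_pCons_0 degree_monom_eq degree_pCons_0 monom_0 monom_eq_0)
  then show ?thesis by (simp add: homog_def triv_grading_def)
qed

context grading
begin

lemma hom_lifted: "comm_ring_hom (\<lambda>c. map_poly (\<lambda>a. [:a:]) (H c))"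
  by (rule comm_ring_hom_compose[OF comm_ring_hom_axioms
        comm_ring_hom_map_poly[OF comm_ring_hom_const_poly]])

text \<open>With X the variable of p and T the grading variable, \<open>lift_grading\<close> sends
  the sum of a_i X^i to the sum of H(a_i) (X T^w)^i. The case distinction guards the truncated
  subtraction.\<close>

lemma coeff_lift_grading:
  "coeff (coeff (lift_grading w H p) k) i =
     (if w * i \<le> k then coeff (H (coeff p i)) (k - w * i) else 0)"
proof (induction p arbitrary: k i)
  case 0
  show ?case by (simp add: lift_grading_def eval_poly_simps[OF hom_lifted])
next
  case (pCons a p)
  have "lift_grading w H (pCons a p) =
      map_poly (\<lambda>a. [:a:]) (H a) + monom [:0, 1:] w * lift_grading w H p"
    by (simp add: lift_grading_def eval_poly_pCons[OF hom_lifted])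
  then have *: "coeff (coeff (lift_grading w H (pCons a p)) k) i =
      coeff [:coeff (H a) k:] i + coeff (if w \<le> k then pCons 0 (coeff (lift_grading w H p) (k - w)) else 0) i"
    by (simp add: coeff_map_poly coeff_monom_mult)
  show ?case
  proof (cases i)
    case 0
    then show ?thesis using * by simp
  next
    case (Suc j)
    then show ?thesis using * pCons.IH[of "k - w" j] by (auto simp: algebra_simps)
  qed
qed

lemma grading_lift: "grading (lift_grading w H)"
proof -
  have hom: "comm_ring_hom (lift_grading w H)"
    unfolding lift_grading_def by (rule comm_ring_hom_eval_poly[OF hom_lifted])
  have "poly (lift_grading w H p) 1 = p" for p
  proof (induction p)
    case 0
    show ?case by (simp add: lift_grading_def eval_poly_simps[OF hom_lifted])
  next
    case (pCons a p)
    interpret c: comm_ring_hom "\<lambda>a::'r. [:a:]" by (rule comm_ring_hom_const_poly)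
    have "lift_grading w H (pCons a p) =
        map_poly (\<lambda>a. [:a:]) (H a) + monom [:0, 1:] w * lift_grading w H p"
      by (simp add: lift_grading_def eval_poly_pCons[OF hom_lifted])
    then show ?case using pCons.IH poly_1[of a] by (simp add: poly_monom)
  qed
  with hom show ?thesis by (simp add: grading_def grading_axioms_def)
qed

lemma homog_lift:
  "homog (lift_grading w H) d p \<longleftrightarrow>
     (\<forall>i. coeff p i \<noteq> 0 \<longrightarrow> w * i \<le> d \<and> homog H (d - w * i) (coeff p i))"
proof
  assume "homog (lift_grading w H) d p"
  then have eq: "coeff (coeff (lift_grading w H p) k) i = (if k = d then coeff p i else 0)" for k i
    by (simp add: homog_def)
  show "\<forall>i. coeff p i \<noteq> 0 \<longrightarrow> w * i \<le> d \<and> homog H (d - w * i) (coeff p i)"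
  proof (intro allI impI conjI)
    fix i assume nz: "coeff p i \<noteq> 0"
    show le: "w * i \<le> d"
      using eq[of d i] nz coeff_lift_grading[of w p d i] by (auto split: if_splits)
    show "homog H (d - w * i) (coeff p i)"
      unfolding homog_def
    proof (rule poly_eqI)
      fix k
      show "coeff (H (coeff p i)) k = coeff (monom (coeff p i) (d - w * i)) k"
        using eq[of "k + w * i" i] coeff_lift_grading[of w p "k + w * i" i] le by auto
    qed
  qed
next
  assume R: "\<forall>i. coeff p i \<noteq> 0 \<longrightarrow> w * i \<le> d \<and> homog H (d - w * i) (coeff p i)"
  show "homog (lift_grading w H) d p"
    unfolding homog_def
  proof (intro poly_eqI)
    fix k i
    show "coeff (coeff (lift_grading w H p) k) i = coeff (coeff (monom p d) k) i"
      using R[rule_format, of i]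
      by (cases "coeff p i = 0") (auto simp: coeff_lift_grading homog_def)
  qed
qed

lemma homog_0: "homog H d 0"
  by (simp add: homog_def)

lemma homog_add: "homog H d p \<Longrightarrow> homog H d q \<Longrightarrow> homog H d (p + q)"
  by (simp add: homog_def hom_add add_monom)

lemma homog_minus: "homog H d p \<Longrightarrow> homog H d (- p)"
  by (simp add: homog_def hom_uminus minus_monom)

lemma homog_mult: "homog H d p \<Longrightarrow> homog H e q \<Longrightarrow> homog H (d + e) (p * q)"
  by (simp add: homog_def hom_mult mult_monom)

lemma homog_1: "homog H 0 1"
  by (simp add: homog_def)

lemma homog_sum: "(\<And>i. i \<in> I \<Longrightarrow> homog H d (p i)) \<Longrightarrow> homog H d (\<Sum>i\<in>I. p i)"
  by (induction I rule: infinite_finite_induct) (auto intro: homog_add homog_0)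

lemma homog_prod:
  "finite I \<Longrightarrow> (\<And>i. i \<in> I \<Longrightarrow> homog H (d i) (p i)) \<Longrightarrow> homog H (\<Sum>i\<in>I. d i) (\<Prod>i\<in>I. p i)"
  by (induction I rule: finite_induct) (auto intro: homog_mult homog_1)

text \<open>Each term of the Leibniz formula takes one entry from every row, so all terms have the
  same degree. The degree may vary with the row because the rows of a Sylvester matrix come from two
  polynomials.\<close>

lemma homog_det:
  assumes "A \<in> carrier_mat n n" "\<And>i j. i < n \<Longrightarrow> j < n \<Longrightarrow> homog H (d i) (A $$ (i, j))"
  shows "homog H (\<Sum>i<n. d i) (det A)"
proof -
  have "homog H (0 + (\<Sum>i\<in>{0..<n}. d i)) (signof \<sigma> * (\<Prod>i = 0..<n. A $$ (i, \<sigma> i)))"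
    if "\<sigma> permutes {0..<n}" for \<sigma>
  proof (rule homog_mult)
    show "homog H 0 (signof \<sigma>)"
      by (auto simp: sign_def intro: homog_1 homog_minus)
    show "homog H (\<Sum>i\<in>{0..<n}. d i) (\<Prod>i = 0..<n. A $$ (i, \<sigma> i))"
      using that permutes_in_image[OF that] by (intro homog_prod) (auto intro!: assms(2))
  qed
  then show ?thesis
    unfolding det_def'[OF assms(1)] by (auto intro!: homog_sum simp: lessThan_atLeast0)
qed

lemma homog_unique: "homog H d p \<Longrightarrow> homog H e p \<Longrightarrow> p \<noteq> 0 \<Longrightarrow> d = e"
  by (metis homog_def degree_monom_eq)

end

text \<open>Over a domain the degree and the order at 0 are both additive, and the order is at most
  the degree. They agree for a monomial, hence for both factors, and a polynomial whose order equals
  its degree is a monomial.\<close>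

lemma mult_eq_monomE:
  fixes p q :: "'r::idom poly"
  assumes "p * q = monom c d" "c \<noteq> 0"
  obtains u v e f where "p = monom u e" "q = monom v f" "e + f = d"
proof -
  have nz: "p * q \<noteq> 0" using assms by simp
  have "degree (p * q) = d" "Polynomial.order 0 (p * q) = d"
    using assms by (auto simp: degree_monom_eq order_0_monom)
  then have "degree p + degree q = d" "Polynomial.order 0 p + Polynomial.order 0 q = d"
    using nz by (auto simp: degree_mult_eq order_mult)
  moreover have "Polynomial.order 0 p \<le> degree p" "Polynomial.order 0 q \<le> degree q"
    using nz by (auto intro: order_degree)
  ultimately have o: "Polynomial.order 0 p = degree p" "Polynomial.order 0 q = degree q" by auto
  have *: "\<exists>u. r = monom u (degree r)" if "Polynomial.order 0 r = degree r" "r \<noteq> 0" for r :: "'r poly"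
  proof (rule exI, rule poly_eqI)
    have "monom 1 (degree r) dvd r" using that by (simp add: monom_1_dvd_iff)
    then show "coeff r k = coeff (monom (lead_coeff r) (degree r)) k" for k
      by (cases k "degree r" rule: linorder_cases) (auto simp: monom_1_dvd_iff' coeff_eq_0)
  qed
  show thesis using *[OF o(1)] *[OF o(2)] nz \<open>degree p + degree q = d\<close> that by fastforce
qed

lemma homog_factors:
  fixes H :: "'r::idom \<Rightarrow> 'r poly"
  assumes "grading H" "homog H d (p * q)" "p * q \<noteq> 0"
  shows "\<exists>e\<le>d. homog H e p \<and> homog H (d - e) q"
proof -
  interpret grading H by fact
  have "H p * H q = monom (p * q) d" using assms(2) by (simp add: homog_def hom_mult)
  then obtain u v e f where *: "H p = monom u e" "H q = monom v f" "e + f = d"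
    using assms(3) by (rule mult_eq_monomE)
  have "u = p" "v = q" using poly_1[of p] poly_1[of q] * by (auto simp: poly_monom)
  then show ?thesis using * by (intro exI[of _ e]) (auto simp: homog_def)
qed

section \<open>Sylvester matrices\<close>

text \<open>Row i of the Sylvester matrix read as a polynomial: the coefficient of x^k stands in
  column m + n - 1 - k. Here m and n are formal degrees, which may exceed the actual ones.\<close>

definition sylvester_row :: "nat \<Rightarrow> nat \<Rightarrow> 'r::comm_ring_1 poly \<Rightarrow> 'r poly \<Rightarrow> nat \<Rightarrow> 'r poly" where
  "sylvester_row m n p q i =
     (if i < n then monom 1 (n - 1 - i) * p else monom 1 (m + n - 1 - i) * q)"

lemma sylvester_index_row:
  fixes p q :: "'r::comm_ring_1 poly"
  assumes "\<forall>k>m. coeff p k = 0" "\<forall>k>n. coeff q k = 0" "i < m + n" "k < m + n"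
  shows "sylvester_mat_sub m n p q $$ (i, m + n - 1 - k) = coeff (sylvester_row m n p q i) k"
proof -
  have j: "m + n - 1 - k < m + n" using assms by auto
  show ?thesis
  proof (cases "i < n")
    case True
    have "i \<le> m + n - 1 - k \<and> m + n - 1 - k - i \<le> m \<Longrightarrow> m + i - (m + n - 1 - k) = k - (n - 1 - i)"
      using True assms(3,4) by linarith
    moreover have "m < k - (n - 1 - i)" if "\<not> i \<le> m + n - 1 - k"
      using True assms(3,4) that by linarith
    moreover have "n - 1 - i \<le> k" if "m + n - 1 - k - i \<le> m"
      using True assms(3,4) that by linarith
    moreover have "\<not> n - 1 - i \<le> k" if "\<not> m + n - 1 - k - i \<le> m"
      using True assms(3,4) that by linarith
    ultimately show ?thesis
      using True assms(1) unfolding sylvester_mat_sub_index[OF assms(3) j]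
      by (auto simp: sylvester_row_def coeff_monom_mult)
  next
    case False
    have "m + n - 1 - k \<le> i \<Longrightarrow> i - (m + n - 1 - k) = k - (m + n - 1 - i)"
      using False assms(3,4) by linarith
    moreover have "n < k - (m + n - 1 - i)" if "\<not> i - n \<le> m + n - 1 - k"
      using False assms(3,4) that by linarith
    moreover have "m + n - 1 - i \<le> k \<longleftrightarrow> m + n - 1 - k \<le> i"
      using False assms(3,4) by linarith
    ultimately show ?thesis
      using False assms(2) unfolding sylvester_mat_sub_index[OF assms(3) j]
      by (auto simp: sylvester_row_def coeff_monom_mult)
  qed
qed

lemma coeff_sylvester_row_eq_0:
  assumes "\<forall>k>m. coeff p k = 0" "\<forall>k>n. coeff q k = 0" "i < m + n" "k \<ge> m + n"
  shows "coeff (sylvester_row m n p q i) k = 0"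
  using assms by (auto simp: sylvester_row_def coeff_monom_mult)

lemma sum_lessThan_add:
  fixes f :: "nat \<Rightarrow> 'a::comm_monoid_add"
  shows "(\<Sum>i<n + m. f i) = (\<Sum>i<n. f i) + (\<Sum>i<m. f (n + i))"
  by (induction m) (simp_all add: add.assoc)

lemma coeff_sum_monom_rev:
  assumes "i < n"
  shows "coeff (\<Sum>i<n. monom (v i) (n - 1 - i)) (n - 1 - i) = v i"
proof -
  have "coeff (\<Sum>i<n. monom (v i) (n - 1 - i)) (n - 1 - i) = (\<Sum>j<n. if j = i then v j else 0)"
    unfolding coeff_sum using assms by (intro sum.cong) auto
  also have "\<dots> = v i" using assms by simp
  finally show ?thesis .
qed

text \<open>A nonzero vector of the left kernel (the kernel of the transpose) is a vanishing
  combination of the rows x^j p and x^j q. Its first n entries are the coefficients of U, its last m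
  entries those of V, in descending order.\<close>

lemma det_sylvester_eq_0E:
  fixes p q :: "'r::idom poly"
  assumes p: "\<forall>k>m. coeff p k = 0" and q: "\<forall>k>n. coeff q k = 0"
    and det: "det (sylvester_mat_sub m n p q) = 0"
  obtains U V where "U \<noteq> 0 \<or> V \<noteq> 0" "\<forall>k\<ge>n. coeff U k = 0" "\<forall>k\<ge>m. coeff V k = 0"
    "U * p + V * q = 0"
proof -
  let ?N = "m + n" and ?S = "sylvester_mat_sub m n p q"
  have "det (transpose_mat ?S) = 0"
    using det det_transpose[of ?S ?N] by (simp add: sylvester_mat_sub_carrier)
  then obtain v where v: "v \<in> carrier_vec ?N" "v \<noteq> 0\<^sub>v ?N" "transpose_mat ?S *\<^sub>v v = 0\<^sub>v ?N"
    using det_0_iff_vec_prod_zero[of "transpose_mat ?S" ?N] by (auto simp: sylvester_mat_sub_carrier)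
  have sum0: "(\<Sum>i<?N. smult (v $ i) (sylvester_row m n p q i)) = 0"
  proof (rule poly_eqI)
    fix k
    show "coeff (\<Sum>i<?N. smult (v $ i) (sylvester_row m n p q i)) k = coeff 0 k"
    proof (cases "k < ?N")
      case True
      then have j: "?N - 1 - k < ?N" by simp
      have "0 = (transpose_mat ?S *\<^sub>v v) $ (?N - 1 - k)" using v(3) j by simp
      also have "\<dots> = (\<Sum>i<?N. v $ i * ?S $$ (i, ?N - 1 - k))"
        using v(1) j by (simp add: scalar_prod_def lessThan_atLeast0 mult.commute)
      also have "\<dots> = (\<Sum>i<?N. v $ i * coeff (sylvester_row m n p q i) k)"
        using True by (intro sum.cong) (auto simp: sylvester_index_row[OF p q, simplified])
      finally show ?thesis by (simp add: coeff_sum)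
    next
      case False
      then show ?thesis by (simp add: coeff_sum coeff_sylvester_row_eq_0[OF p q])
    qed
  qed
  define U where "U = (\<Sum>i<n. monom (v $ i) (n - 1 - i))"
  define V where "V = (\<Sum>i<m. monom (v $ (n + i)) (m - 1 - i))"
  have "U * p + V * q = (\<Sum>i<n + m. smult (v $ i) (sylvester_row m n p q i))"
    unfolding sum_lessThan_add U_def V_def sum_distrib_right
    by (intro arg_cong2[of _ _ _ _ "(+)"] sum.cong)
      (auto simp: sylvester_row_def smult_monom simp flip: mult_smult_left)
  then have "U * p + V * q = 0" using sum0 by (simp add: add.commute)
  moreover have "U \<noteq> 0 \<or> V \<noteq> 0"
  proof -
    obtain i where i: "i < ?N" "v $ i \<noteq> 0"
      using v(1,2) by (metis eq_vecI carrier_vecD index_zero_vec)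
    show ?thesis
    proof (cases "i < n")
      case True
      then show ?thesis using i coeff_sum_monom_rev[of i n "\<lambda>i. v $ i"] by (auto simp: U_def)
    next
      case False
      then have "i - n < m" using i(1) by linarith
      then show ?thesis using False i coeff_sum_monom_rev[of "i - n" m "\<lambda>i. v $ (n + i)"]
        by (auto simp: V_def)
    qed
  qed
  moreover have "\<forall>k\<ge>n. coeff U k = 0" "\<forall>k\<ge>m. coeff V k = 0"
    unfolding U_def V_def by (auto simp: coeff_sum intro!: sum.neutral)
  ultimately show thesis using that by blast
qed

text \<open>The value at (s, u) of the binary form of degree n with dehomogenization p. It keeps the
  point (1, 0) at infinity, which is a zero exactly when the formal leading coefficient
  vanishes.\<close>

definition hform :: "nat \<Rightarrow> 'r::comm_ring_1 poly \<Rightarrow> 'r \<Rightarrow> 'r \<Rightarrow> 'r" where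
  "hform n p s u = (\<Sum>k\<le>n. coeff p k * s ^ k * u ^ (n - k))"

lemma hform_1:
  assumes "\<forall>k>n. coeff p k = 0"
  shows "hform n p x 1 = poly p x"
proof -
  have "degree p \<le> n" using assms by (simp add: degree_le)
  then have "poly p x = (\<Sum>k\<le>n. coeff p k * x ^ k)"
    unfolding poly_altdef by (intro sum.mono_neutral_left) (auto simp: coeff_eq_0)
  then show ?thesis by (simp add: hform_def)
qed

lemma hform_monom_mult:
  assumes "\<forall>k>m. coeff p k = 0" "a + m \<le> N"
  shows "hform N (monom 1 a * p) s u = s ^ a * u ^ (N - a - m) * hform m p s u"
proof -
  have "hform N (monom 1 a * p) s u = (\<Sum>k\<in>{a..a + m}. coeff (monom 1 a * p) k * s ^ k * u ^ (N - k))"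
    unfolding hform_def using assms by (intro sum.mono_neutral_right) (auto simp: coeff_monom_mult)
  also have "\<dots> = (\<Sum>k\<in>{0..m}. coeff (monom 1 a * p) (k + a) * s ^ (k + a) * u ^ (N - (k + a)))"
    using sum.shift_bounds_cl_nat_ivl[of _ 0 a m] by (simp add: add.commute)
  also have "\<dots> = (\<Sum>k\<le>m. s ^ a * u ^ (N - a - m) * (coeff p k * s ^ k * u ^ (m - k)))"
  proof (rule sum.cong)
    fix k assume "k \<in> {..m}"
    then have "N - (k + a) = (N - a - m) + (m - k)" using assms(2) by auto
    then show "coeff (monom 1 a * p) (k + a) * s ^ (k + a) * u ^ (N - (k + a)) =
        s ^ a * u ^ (N - a - m) * (coeff p k * s ^ k * u ^ (m - k))"
      by (simp add: coeff_monom_mult power_add)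
  qed auto
  finally show ?thesis by (simp add: hform_def sum_distrib_left)
qed

text \<open>The vector of all monomials of degree m + n - 1 at (s, u) lies in the right kernel: its
  product with a row is a multiple of the value of one of the two forms. The first or the last entry
  is nonzero. For m + n = 0 the determinant is empty and equals 1.\<close>

lemma det_sylvester_common_zero:
  fixes p q :: "'r::idom poly"
  assumes p: "\<forall>k>m. coeff p k = 0" and q: "\<forall>k>n. coeff q k = 0"
    and "hform m p s u = 0" "hform n q s u = 0" and "(s, u) \<noteq> (0, 0)" and "m + n > 0"
  shows "det (sylvester_mat_sub m n p q) = 0"
proof -
  let ?N = "m + n" and ?S = "sylvester_mat_sub m n p q"
  define v where "v = vec ?N (\<lambda>j. s ^ (?N - 1 - j) * u ^ j)"
  have "v $ 0 \<noteq> 0 \<or> v $ (?N - 1) \<noteq> 0" using assms(5,6) by (auto simp: v_def)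
  then have v: "v \<in> carrier_vec ?N" "v \<noteq> 0\<^sub>v ?N"
    using assms(6) by (simp add: v_def, metis index_zero_vec(1) add_pos_pos diff_less less_numeral_extra(1))
  have "?S *\<^sub>v v = 0\<^sub>v ?N"
  proof (rule eq_vecI)
    fix i assume "i < dim_vec (0\<^sub>v ?N :: 'r vec)"
    then have i: "i < ?N" by simp
    have "(?S *\<^sub>v v) $ i = (\<Sum>j<?N. ?S $$ (i, j) * (s ^ (?N - 1 - j) * u ^ j))"
      using i by (simp add: scalar_prod_def v_def lessThan_atLeast0)
    also have "\<dots> = (\<Sum>k<?N. ?S $$ (i, ?N - 1 - k) * (s ^ k * u ^ (?N - 1 - k)))"
      by (rule sum.reindex_bij_witness[of _ "\<lambda>k. ?N - 1 - k" "\<lambda>k. ?N - 1 - k"]) auto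
    also have "\<dots> = (\<Sum>k\<le>?N - 1. coeff (sylvester_row m n p q i) k * s ^ k * u ^ (?N - 1 - k))"
      using i by (intro sum.cong) (auto simp: sylvester_index_row[OF p q, simplified] mult.assoc)
    also have "\<dots> = hform (?N - 1) (sylvester_row m n p q i) s u"
      by (simp add: hform_def)
    also have "\<dots> = 0"
      using i assms(3,4) p q by (cases "i < n") (auto simp: sylvester_row_def hform_monom_mult)
    finally show "(?S *\<^sub>v v) $ i = 0\<^sub>v ?N $ i" using i by simp
  qed simp
  with v show ?thesis
    using det_0_iff_vec_prod_zero[OF sylvester_mat_sub_carrier[of m n p q]] by blast
qed

lemma dvd_mult_no_common_root:
  fixes p q r :: "'k::alg_closed_field poly"
  assumes "\<And>x. poly p x = 0 \<Longrightarrow> poly q x \<noteq> 0" "p dvd r * q" "p \<noteq> 0"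
  shows "p dvd r"
  using assms
proof (induction "degree p" arbitrary: p r)
  case 0
  then show ?case by (metis degree_eq_zeroE dvd_trans is_unit_iff_degree one_dvd)
next
  case (Suc d)
  obtain x where x: "poly p x = 0" using alg_closed_imp_poly_has_root[of p] Suc.hyps(2) by auto
  then obtain p' where p': "p = [:- x, 1:] * p'" by (metis poly_eq_0_iff_dvd dvdE)
  have "poly (r * q) x = 0" using Suc.prems(2) x by (metis dvd_trans poly_eq_0_iff_dvd)
  then have "poly r x = 0" using Suc.prems(1)[OF x] by simp
  then obtain r' where r': "r = [:- x, 1:] * r'" by (metis poly_eq_0_iff_dvd dvdE)
  have nz: "[:- x, 1:] \<noteq> 0" "p' \<noteq> 0" using Suc.prems(3) p' by auto
  have "[:- x, 1:] * p' dvd [:- x, 1:] * (r' * q)"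
    using Suc.prems(2) unfolding p' r' by (simp only: mult.assoc)
  then have "p' dvd r' * q" using nz(1) by (simp only: dvd_mult_cancel_left) simp
  moreover have "degree p = degree [:- x, 1:] + degree p'"
    unfolding p' using nz by (rule degree_mult_eq)
  then have "d = degree p'" using Suc.hyps(2) by simp
  ultimately have "p' dvd r'" using Suc.hyps(1)[of p' r'] Suc.prems(1) nz(2) by (auto simp: p')
  then show ?case unfolding p' r' by (rule mult_dvd_mono[OF dvd_refl])
qed

text \<open>If both formal leading coefficients vanish, (1, 0) is a common zero. Otherwise one
  polynomial has its full formal degree. Without a common root it divides its partner's cofactor in
  U p + V q = 0, whose degree is too small.\<close>

lemma det_sylvester_eq_0_imp_common_zero:
  fixes p q :: "'k::alg_closed_field poly"
  assumes p: "\<forall>k>m. coeff p k = 0" and q: "\<forall>k>n. coeff q k = 0"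
    and det: "det (sylvester_mat_sub m n p q) = 0"
  shows "\<exists>s u. (s, u) \<noteq> (0, 0) \<and> hform m p s u = 0 \<and> hform n q s u = 0"
proof -
  have infinity: "hform m p 1 0 = coeff p m" for m and p :: "'k poly"
  proof -
    have "hform m p 1 0 = (\<Sum>k\<le>m. if k = m then coeff p k else 0)"
      unfolding hform_def by (intro sum.cong) (auto simp: power_0_left)
    then show ?thesis by simp
  qed
  obtain U V where UV: "U \<noteq> 0 \<or> V \<noteq> 0" "\<forall>k\<ge>n. coeff U k = 0" "\<forall>k\<ge>m. coeff V k = 0"
    "U * p + V * q = 0"
    by (rule det_sylvester_eq_0E[OF p q det])
  have small: "r = 0" if "f dvd r" "coeff f m \<noteq> 0" "\<forall>k\<ge>m. coeff r k = 0" for f r :: "'k poly" and m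
  proof (rule ccontr)
    assume "r \<noteq> 0"
    then have "degree f \<le> degree r" using that(1) by (rule dvd_imp_degree_le[rotated])
    moreover have "m \<le> degree f" using that(2) by (rule le_degree)
    ultimately show False using that(3) \<open>r \<noteq> 0\<close> by (metis leading_coeff_0_iff order.trans)
  qed
  show ?thesis
  proof (cases "coeff p m = 0 \<and> coeff q n = 0")
    case True
    then show ?thesis by (intro exI[of _ 1] exI[of _ 0]) (simp add: infinity)
  next
    case False
    have "\<exists>x. poly p x = 0 \<and> poly q x = 0"
    proof (rule ccontr)
      assume nocommon: "\<not> ?thesis"
      have "U = 0 \<and> V = 0"
      proof (cases "coeff p m = 0")
        case False
        have "V * q = p * (- U)" using UV(4) by (simp add: algebra_simps eq_neg_iff_add_eq_0)
        then have "p dvd V * q" by simp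
        then have "p dvd V" using nocommon False by (intro dvd_mult_no_common_root[of p q V]) auto
        then have "V = 0" using small False UV(3) by blast
        then show ?thesis using UV(4) False by auto
      next
        case True
        then have nz: "coeff q n \<noteq> 0" using False by simp
        have "U * p = q * (- V)" using UV(4) by (simp add: algebra_simps eq_neg_iff_add_eq_0)
        then have "q dvd U * p" by simp
        then have "q dvd U" using nocommon nz by (intro dvd_mult_no_common_root[of q p U]) auto
        then have "U = 0" using small nz UV(2) by blast
        then show ?thesis using UV(4) nz by auto
      qed
      then show False using UV(1) by simp
    qed
    then obtain x where "poly p x = 0" "poly q x = 0" by blast
    then show ?thesis by (intro exI[of _ x] exI[of _ 1]) (simp add: hform_1 p q)
  qed
qed

section \<open>A Nullstellensatz for hypersurfaces\<close>

text \<open>A set of points of the ring (homomorphisms to the field) that is dense and satisfies the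
  Nullstellensatz for principal prime ideals. Formulated for an arbitrary factorial ring, it can be
  carried along when one variable is adjoined.\<close>

definition nullstellensatz_points ::
  "('r::ufd \<Rightarrow> 'k::{alg_closed_field, field_char_0}) set \<Rightarrow> bool" where
  "nullstellensatz_points \<Phi> \<longleftrightarrow> (\<forall>\<phi>\<in>\<Phi>. comm_ring_hom \<phi>) \<and>
     (\<forall>r. r \<noteq> 0 \<longrightarrow> (\<exists>\<phi>\<in>\<Phi>. \<phi> r \<noteq> 0)) \<and>
     (\<forall>F G. irreducible F \<longrightarrow> (\<forall>\<phi>\<in>\<Phi>. \<phi> F = 0 \<longrightarrow> \<phi> G = 0) \<longrightarrow> F dvd G)"

definition extend_points :: "('r::ufd \<Rightarrow> 'k::{alg_closed_field, field_char_0}) set \<Rightarrow> ('r poly \<Rightarrow> 'k) set" where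
  "extend_points \<Phi> = {\<lambda>p. eval_poly \<phi> p x | \<phi> x. \<phi> \<in> \<Phi>}"

lemma poly_eq_0_all:
  fixes p :: "'k::{idom, ring_char_0} poly"
  assumes "\<And>x. poly p x = 0"
  shows "p = 0"
  using assms poly_all_0_iff_0 by blast

text \<open>F is prime, so a relation U F + V G = 0 makes F divide V, which has smaller
  degree.\<close>

lemma det_sylvester_irreducible:
  fixes F G :: "'r::ufd poly"
  assumes "irreducible F" "\<not> F dvd G"
  shows "det (sylvester_mat_sub (degree F) (degree G) F G) \<noteq> 0"
proof
  assume det: "det (sylvester_mat_sub (degree F) (degree G) F G) = 0"
  obtain U V where UV: "U \<noteq> 0 \<or> V \<noteq> 0" "\<forall>k\<ge>degree F. coeff V k = 0" "U * F + V * G = 0"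
    by (rule det_sylvester_eq_0E[OF _ _ det]) (auto simp: coeff_eq_0)
  have prime: "prime_elem F" using assms(1) by simp
  have "V * G = F * (- U)" using UV(3) by (simp add: algebra_simps eq_neg_iff_add_eq_0)
  then have "F dvd V * G" by simp
  then have "F dvd V" using prime assms(2) by (simp add: prime_elem_dvd_mult_iff)
  have "V = 0"
  proof (rule ccontr)
    assume "V \<noteq> 0"
    then have "degree F \<le> degree V" using \<open>F dvd V\<close> by (rule dvd_imp_degree_le[rotated])
    then have "lead_coeff V = 0" using UV(2) by blast
    then show False using \<open>V \<noteq> 0\<close> by simp
  qed
  then show False using UV(1,3) assms(1) by (auto simp: irreducible_def)
qed

text \<open>If F involves the new variable and does not divide G, the resultant of F and G is
  nonzero and remains so at some point of the base. Above this point F still has a root, G vanishes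
  there too, and so the specialized resultant vanishes. If F is constant in the new variable, the
  coefficients of G are treated one by one.\<close>

lemma nullstellensatz_points_extend:
  assumes "nullstellensatz_points \<Phi>"
  shows "nullstellensatz_points (extend_points \<Phi>)"
  unfolding nullstellensatz_points_def
proof (intro conjI ballI allI impI)
  fix \<psi> assume "\<psi> \<in> extend_points \<Phi>"
  then show "comm_ring_hom \<psi>"
    using assms by (auto simp: extend_points_def nullstellensatz_points_def intro: comm_ring_hom_eval_poly)
next
  fix p :: "'a poly" assume "p \<noteq> 0"
  then have "lead_coeff p \<noteq> 0" by simp
  then obtain \<phi> where \<phi>: "\<phi> \<in> \<Phi>" "\<phi> (lead_coeff p) \<noteq> 0"
    using assms unfolding nullstellensatz_points_def by blast
  then interpret comm_ring_hom \<phi> using assms by (auto simp: nullstellensatz_points_def)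
  have "coeff (map_poly \<phi> p) (degree p) \<noteq> 0" using \<phi> by simp
  then have "map_poly \<phi> p \<noteq> 0" by (metis coeff_0)
  then obtain x where "poly (map_poly \<phi> p) x \<noteq> 0" using poly_eq_0_all by blast
  then show "\<exists>\<psi>\<in>extend_points \<Phi>. \<psi> p \<noteq> 0"
    using \<phi> by (auto simp: extend_points_def eval_poly_def)
next
  fix F G :: "'a poly"
  assume irr: "irreducible F" and van: "\<forall>\<psi>\<in>extend_points \<Phi>. \<psi> F = 0 \<longrightarrow> \<psi> G = 0"
  have van': "poly (map_poly \<phi> F) x = 0 \<Longrightarrow> poly (map_poly \<phi> G) x = 0" if "\<phi> \<in> \<Phi>" for \<phi> x
    using van[rule_format, of "\<lambda>p. eval_poly \<phi> p x"] that
    by (auto simp: extend_points_def eval_poly_def)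
  show "F dvd G"
  proof (cases "degree F = 0")
    case True
    then obtain f where F: "F = [:f:]" by (rule degree_eq_zeroE)
    have f: "irreducible f" using irr F by (simp add: irreducible_const_poly_iff)
    have "f dvd coeff G i" for i
    proof -
      have "\<phi> (coeff G i) = 0" if "\<phi> \<in> \<Phi>" "\<phi> f = 0" for \<phi>
      proof -
        interpret comm_ring_hom \<phi> using assms that by (auto simp: nullstellensatz_points_def)
        have "map_poly \<phi> G = 0" using van'[OF that(1)] that(2) by (intro poly_eq_0_all) (simp add: F map_poly_pCons_hom)
        then have "coeff (map_poly \<phi> G) i = 0" by simp
        then show ?thesis by simp
      qed
      then show ?thesis using assms f unfolding nullstellensatz_points_def by blast
    qed
    then show ?thesis by (simp add: F const_poly_dvd_iff)
  next
    case False
    show ?thesis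
    proof (rule ccontr)
      assume "\<not> F dvd G"
      let ?S = "sylvester_mat_sub (degree F) (degree G) F G"
      \<comment> \<open>The factor \<open>lead_coeff F\<close> keeps the degree of the specialized F
        positive, so that it has a root.\<close>
      have "det ?S * lead_coeff F \<noteq> 0"
        using det_sylvester_irreducible[OF irr \<open>\<not> F dvd G\<close>] False by auto
      then obtain \<phi> where \<phi>: "\<phi> \<in> \<Phi>" "\<phi> (det ?S * lead_coeff F) \<noteq> 0"
        using assms unfolding nullstellensatz_points_def by blast
      interpret comm_ring_hom \<phi> using assms \<phi> by (auto simp: nullstellensatz_points_def)
      let ?F = "map_poly \<phi> F" and ?G = "map_poly \<phi> G"
      have nz: "\<phi> (det ?S) \<noteq> 0" "\<phi> (lead_coeff F) \<noteq> 0" using \<phi>(2) by (auto simp: hom_mult)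
      then have "coeff ?F (degree F) \<noteq> 0" by simp
      then have "degree F \<le> degree ?F" by (rule le_degree)
      then obtain x where x: "poly ?F x = 0" using alg_closed_imp_poly_has_root[of ?F] False by auto
      have "det (sylvester_mat_sub (degree F) (degree G) ?F ?G) = 0"
        by (rule det_sylvester_common_zero[of _ _ _ _ x 1])
          (use False x van'[OF \<phi>(1) x] in \<open>auto simp: coeff_eq_0 hform_1\<close>)
      then have "\<phi> (det ?S) = 0" by (simp add: sylvester_mat_sub_map[symmetric])
      with nz show False by simp
    qed
  qed
qed

text \<open>A field has no irreducible elements, so the divisibility condition is vacuous.\<close>

lemma nullstellensatz_points_field:
  "nullstellensatz_points {\<lambda>c :: 'k::{alg_closed_field, field_char_0}. c}"
proof -
  have "comm_ring_hom (\<lambda>c :: 'k. c)" by (rule comm_ring_homI) auto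
  then show ?thesis by (auto simp: nullstellensatz_points_def irreducible_def dvd_field_iff)
qed

lemma nullstellensatz4:
  fixes F G :: "'k::{alg_closed_field, field_char_0} poly4"
  assumes "irreducible F" "\<And>x1 x2 x3 x4. eval4 id F x1 x2 x3 x4 = 0 \<Longrightarrow> eval4 id G x1 x2 x3 x4 = 0"
  shows "F dvd G"
proof -
  define \<Phi> where "\<Phi> = extend_points (extend_points (extend_points (extend_points {\<lambda>c :: 'k. c})))"
  have "nullstellensatz_points \<Phi>"
    unfolding \<Phi>_def by (intro nullstellensatz_points_extend nullstellensatz_points_field)
  moreover have "\<exists>x1 x2 x3 x4. \<phi> = (\<lambda>p. eval4 id p x1 x2 x3 x4)" if "\<phi> \<in> \<Phi>" for \<phi>
    using that unfolding \<Phi>_def extend_points_def eval4_def eval2_def id_def by blast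
  ultimately show ?thesis using assms unfolding nullstellensatz_points_def by metis
qed

lemma ex_nonzero_eval2:
  fixes p :: "'k::{alg_closed_field, field_char_0} poly2"
  assumes "p \<noteq> 0"
  shows "\<exists>x y. eval2 id p x y \<noteq> 0"
proof -
  have "nullstellensatz_points (extend_points (extend_points {\<lambda>c :: 'k. c}))"
    by (intro nullstellensatz_points_extend nullstellensatz_points_field)
  then obtain \<phi> where "\<phi> \<in> extend_points (extend_points {\<lambda>c :: 'k. c})" "\<phi> p \<noteq> 0"
    using assms unfolding nullstellensatz_points_def by blast
  then show ?thesis unfolding extend_points_def eval2_def id_def by blast
qed

section \<open>Evaluation\<close>

lemma comm_ring_hom_id: "comm_ring_hom (id :: 'r::comm_ring_1 \<Rightarrow> 'r)"
  by (rule comm_ring_homI) auto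

lemma comm_ring_hom_eval2: "comm_ring_hom \<phi> \<Longrightarrow> comm_ring_hom (\<lambda>p. eval2 \<phi> p x y)"
  unfolding eval2_def by (intro comm_ring_hom_eval_poly)

lemma comm_ring_hom_eval4: "comm_ring_hom \<phi> \<Longrightarrow> comm_ring_hom (\<lambda>p. eval4 \<phi> p x1 x2 x3 x4)"
  unfolding eval4_def by (intro comm_ring_hom_eval2)

lemma comm_ring_hom_eval4_vec: "comm_ring_hom \<phi> \<Longrightarrow> comm_ring_hom (\<lambda>p. eval4_vec \<phi> p x)"
  unfolding eval4_vec_def by (intro comm_ring_hom_eval4)

lemma comm_ring_hom_const2: "comm_ring_hom (const2 :: 'r::comm_ring_1 \<Rightarrow> 'r poly2)"
  unfolding const2_def by (intro comm_ring_hom_compose[OF comm_ring_hom_const_poly comm_ring_hom_const_poly])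

lemma comm_ring_hom_const4: "comm_ring_hom (const4 :: 'r::comm_ring_1 \<Rightarrow> 'r poly4)"
  unfolding const4_def by (intro comm_ring_hom_compose[OF comm_ring_hom_const2 comm_ring_hom_const2])

lemma comm_ring_hom_map_poly2: "comm_ring_hom \<phi> \<Longrightarrow> comm_ring_hom (map_poly2 \<phi>)"
  unfolding map_poly2_def by (intro comm_ring_hom_map_poly)

lemma eval_poly_hom:
  assumes "comm_ring_hom \<phi>" "comm_ring_hom \<theta>"
  shows "\<theta> (eval_poly \<phi> p x) = eval_poly (\<lambda>c. \<theta> (\<phi> c)) p (\<theta> x)"
proof -
  interpret \<theta>: comm_ring_hom \<theta> by fact
  show ?thesis
    by (induction p) (simp_all add: eval_poly_simps eval_poly_pCons assms comm_ring_hom_compose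
        \<theta>.hom_add \<theta>.hom_mult)
qed

lemma eval2_hom:
  assumes "comm_ring_hom \<phi>" "comm_ring_hom \<theta>"
  shows "\<theta> (eval2 \<phi> p x y) = eval2 (\<lambda>c. \<theta> (\<phi> c)) p (\<theta> x) (\<theta> y)"
  unfolding eval2_def
  by (simp add: eval_poly_hom assms comm_ring_hom_eval_poly)

lemma eval4_hom:
  assumes "comm_ring_hom \<phi>" "comm_ring_hom \<theta>"
  shows "\<theta> (eval4 \<phi> p x1 x2 x3 x4) =
    eval4 (\<lambda>c. \<theta> (\<phi> c)) p (\<theta> x1) (\<theta> x2) (\<theta> x3) (\<theta> x4)"
  unfolding eval4_def
  by (simp add: eval2_hom assms comm_ring_hom_eval2)

lemma eval_poly_const: "comm_ring_hom \<phi> \<Longrightarrow> eval_poly \<phi> [:c:] x = \<phi> c"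
  by (simp add: eval_poly_pCons eval_poly_simps)

lemma eval2_const2: "comm_ring_hom \<phi> \<Longrightarrow> eval2 \<phi> (const2 c) x y = \<phi> c"
  by (simp add: eval2_def const2_def eval_poly_const comm_ring_hom_eval_poly)

lemma eval2_var:
  assumes "comm_ring_hom \<phi>"
  shows "eval2 \<phi> var1 x y = x" "eval2 \<phi> var2 x y = y"
proof -
  interpret comm_ring_hom \<phi> by fact
  show "eval2 \<phi> var1 x y = x" "eval2 \<phi> var2 x y = y"
    by (simp_all add: eval2_def var1_def var2_def eval_poly_pCons eval_poly_simps assms
        comm_ring_hom_eval_poly)
qed

lemma eval_poly_map_poly:
  assumes "comm_ring_hom \<phi>" "comm_ring_hom \<rho>"
  shows "eval_poly \<phi> (map_poly \<rho> p) x = eval_poly (\<lambda>c. \<phi> (\<rho> c)) p x"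
proof -
  interpret \<rho>: comm_ring_hom \<rho> by fact
  show ?thesis
    by (induction p) (simp_all add: eval_poly_simps eval_poly_pCons assms comm_ring_hom_compose
        \<rho>.map_poly_pCons_hom)
qed

lemma eval2_map_poly2:
  assumes "comm_ring_hom \<phi>" "comm_ring_hom \<rho>"
  shows "eval2 \<phi> (map_poly2 \<rho> p) x y = eval2 (\<lambda>c. \<phi> (\<rho> c)) p x y"
  unfolding eval2_def map_poly2_def
  by (simp add: eval_poly_map_poly assms comm_ring_hom_eval_poly comm_ring_hom_map_poly)

lemma coeff2_map_poly2: "f 0 = 0 \<Longrightarrow> coeff2 (map_poly2 f p) i j = f (coeff2 p i j)"
  by (simp add: map_poly2_def coeff2_def coeff_map_poly)

lemma coeff2_const2_mult: "coeff2 (const2 c * p) i j = c * coeff2 p i j"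
  by (simp add: coeff2_def const2_def)

lemma coeff2_sum: "coeff2 (\<Sum>k\<in>I. p k) i j = (\<Sum>k\<in>I. coeff2 (p k) i j)"
  by (simp add: coeff2_def coeff_sum)

lemma coeff2_const2: "coeff2 (const2 c) i j = (if i = 0 \<and> j = 0 then c else 0)"
  by (auto simp: coeff2_def const2_def coeff_pCons split: nat.split)

lemma poly2_eqI: "(\<And>i j. coeff2 p i j = coeff2 q i j) \<Longrightarrow> p = q"
  unfolding coeff2_def by (intro poly_eqI)

lemma poly2_nonzeroE:
  assumes "p \<noteq> 0"
  obtains i j where "coeff2 p i j \<noteq> 0"
  using assms by (metis coeff2_def leading_coeff_0_iff)

lemma map_poly2_const2: "f 0 = 0 \<Longrightarrow> map_poly2 f (const2 c) = const2 (f c)"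
  by (rule poly2_eqI) (simp add: coeff2_map_poly2 coeff2_const2)

lemma eval4_of_su: "eval4 id (of_su p) t v s u = eval2 id p s u"
proof -
  have "(\<lambda>c. eval2 id (const2 c) t v) = id"
    by (rule ext) (simp add: eval2_const2 comm_ring_hom_id)
  then show ?thesis
    by (simp add: eval4_def of_su_def eval2_map_poly2 comm_ring_hom_eval2 comm_ring_hom_id
        comm_ring_hom_const2)
qed

lemma eval4_of_tv: "eval4 id (of_tv p) t v s u = eval2 id p t v"
  by (simp add: eval4_def of_tv_def eval2_const2 comm_ring_hom_eval2 comm_ring_hom_id)

section \<open>Homogeneous polynomials in two variables\<close>

definition grad2 :: "'r::comm_ring_1 poly2 \<Rightarrow> 'r poly2 poly" where
  "grad2 = lift_grading 1 (lift_grading 1 triv_grading)"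

definition grad4 :: "'r::comm_ring_1 poly4 \<Rightarrow> 'r poly4 poly" where
  "grad4 = lift_grading 1 (lift_grading 1 grad2)"

text \<open>The degree in t, v on R = K[t,v][s,u]: the outer variables s, u get weight 0.\<close>

definition grad2_inner :: "'r::comm_ring_1 poly4 \<Rightarrow> 'r poly4 poly" where
  "grad2_inner = lift_grading 0 (lift_grading 0 grad2)"

lemma grading_grad2: "grading grad2"
  unfolding grad2_def by (intro grading.grading_lift grading_triv)

lemma grading_grad4: "grading grad4"
  unfolding grad4_def by (intro grading.grading_lift grading_grad2)

lemma grading_grad2_inner: "grading grad2_inner"
  unfolding grad2_inner_def by (intro grading.grading_lift grading_grad2)

lemma homog_grad2: "homog grad2 d p \<longleftrightarrow> homogeneous2 d p"
proof -
  have "homog grad2 d p \<longleftrightarrow> (\<forall>j. coeff p j \<noteq> 0 \<longrightarrow> j \<le> d \<and>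
      (\<forall>i. coeff (coeff p j) i \<noteq> 0 \<longrightarrow> i \<le> d - j \<and> d - j - i = 0))"
    unfolding grad2_def
    by (auto simp: grading.homog_lift[OF grading.grading_lift[OF grading_triv]]
        grading.homog_lift[OF grading_triv] homog_triv)
  also have "\<dots> \<longleftrightarrow> homogeneous2 d p"
    unfolding homogeneous2_def coeff2_def
  proof (intro iffI allI impI conjI)
    fix i j assume "\<forall>j. coeff p j \<noteq> 0 \<longrightarrow> j \<le> d \<and>
      (\<forall>i. coeff (coeff p j) i \<noteq> 0 \<longrightarrow> i \<le> d - j \<and> d - j - i = 0)" "coeff (coeff p j) i \<noteq> 0"
    then show "i + j = d" by (metis add.commute coeff_0 diff_is_0_eq le_add_diff_inverse le_antisym)
  next
    fix j assume *: "\<forall>i j. coeff (coeff p j) i \<noteq> 0 \<longrightarrow> i + j = d" and "coeff p j \<noteq> 0"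
    then show "j \<le> d" using leading_coeff_neq_0[of "coeff p j"] by fastforce
  next
    fix i j assume "\<forall>i j. coeff (coeff p j) i \<noteq> 0 \<longrightarrow> i + j = d" "coeff (coeff p j) i \<noteq> 0"
    then have "i + j = d" by blast
    then show "i \<le> d - j" "d - j - i = 0" by auto
  qed
  finally show ?thesis .
qed

lemma homog_grad4: "homog grad4 d p \<longleftrightarrow> homogeneous4 d p"
proof -
  have "homog grad4 d p \<longleftrightarrow> (\<forall>l. coeff p l \<noteq> 0 \<longrightarrow> l \<le> d \<and>
      (\<forall>k. coeff (coeff p l) k \<noteq> 0 \<longrightarrow> k \<le> d - l \<and> homogeneous2 (d - l - k) (coeff (coeff p l) k)))"
    unfolding grad4_def
    by (auto simp: grading.homog_lift[OF grading.grading_lift[OF grading_grad2]]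
        grading.homog_lift[OF grading_grad2] homog_grad2)
  also have "\<dots> \<longleftrightarrow> homogeneous4 d p"
    unfolding homogeneous4_def coeff4_def homogeneous2_def coeff2_def
  proof (intro iffI allI impI conjI)
    fix i j k l
    assume *: "\<forall>l. coeff p l \<noteq> 0 \<longrightarrow> l \<le> d \<and>
      (\<forall>k. coeff (coeff p l) k \<noteq> 0 \<longrightarrow> k \<le> d - l \<and>
         (\<forall>i j. coeff (coeff (coeff (coeff p l) k) j) i \<noteq> 0 \<longrightarrow> i + j = d - l - k))"
      and nz: "coeff (coeff (coeff (coeff p l) k) j) i \<noteq> 0"
    have "coeff (coeff p l) k \<noteq> 0" "coeff p l \<noteq> 0" using nz by auto
    then have "l \<le> d" "k \<le> d - l" "i + j = d - l - k" using * nz by blast+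
    then show "i + j + k + l = d" by linarith
  next
    fix l
    assume *: "\<forall>i j k l. coeff (coeff (coeff (coeff p l) k) j) i \<noteq> 0 \<longrightarrow> i + j + k + l = d"
      and "coeff p l \<noteq> 0"
    then obtain i j k where "coeff (coeff (coeff (coeff p l) k) j) i \<noteq> 0"
      by (metis leading_coeff_0_iff)
    then show "l \<le> d" using * by fastforce
  next
    fix l k
    assume *: "\<forall>i j k l. coeff (coeff (coeff (coeff p l) k) j) i \<noteq> 0 \<longrightarrow> i + j + k + l = d"
      and "coeff (coeff p l) k \<noteq> 0"
    then obtain i j where "coeff (coeff (coeff (coeff p l) k) j) i \<noteq> 0"
      by (metis leading_coeff_0_iff)
    then show "k \<le> d - l" using * by fastforce
  next
    fix i j k l
    assume *: "\<forall>i j k l. coeff (coeff (coeff (coeff p l) k) j) i \<noteq> 0 \<longrightarrow> i + j + k + l = d"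
      and "coeff (coeff (coeff (coeff p l) k) j) i \<noteq> 0"
    then have "i + j + k + l = d" by blast
    then show "i + j = d - l - k" by linarith
  qed
  finally show ?thesis .
qed

lemma homog_grad2_inner: "homog grad2_inner d p \<longleftrightarrow> (\<forall>i j. homogeneous2 d (coeff2 p i j))"
proof -
  have "homog grad2_inner d p \<longleftrightarrow> (\<forall>j. coeff p j \<noteq> 0 \<longrightarrow>
      (\<forall>i. coeff (coeff p j) i \<noteq> 0 \<longrightarrow> homogeneous2 d (coeff (coeff p j) i)))"
    unfolding grad2_inner_def
    by (auto simp: grading.homog_lift[OF grading.grading_lift[OF grading_grad2]]
        grading.homog_lift[OF grading_grad2] homog_grad2)
  also have "\<dots> \<longleftrightarrow> (\<forall>i j. homogeneous2 d (coeff2 p i j))"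
    unfolding coeff2_def
  proof (intro iffI allI impI)
    fix i j
    assume *: "\<forall>j. coeff p j \<noteq> 0 \<longrightarrow>
      (\<forall>i. coeff (coeff p j) i \<noteq> 0 \<longrightarrow> homogeneous2 d (coeff (coeff p j) i))"
    show "homogeneous2 d (coeff (coeff p j) i)"
    proof (cases "coeff (coeff p j) i = 0")
      case True
      then show ?thesis by (simp add: homogeneous2_def coeff2_def)
    next
      case False
      then have "coeff p j \<noteq> 0" by auto
      with False * show ?thesis by blast
    qed
  qed blast
  finally show ?thesis .
qed

lemma tdegree2_homogeneous:
  assumes "homogeneous2 d p" "p \<noteq> 0"
  shows "tdegree2 p = d"
proof -
  obtain i j where nz: "coeff2 p i j \<noteq> 0"
    using assms(2) by (metis coeff2_def leading_coeff_0_iff)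
  then have "{i + j | i j. coeff2 p i j \<noteq> 0} = {d}"
    using assms(1) unfolding homogeneous2_def by blast
  then show ?thesis by (simp add: tdegree2_def)
qed

definition homogenize :: "nat \<Rightarrow> 'r::comm_ring_1 poly \<Rightarrow> 'r poly2" where
  "homogenize d f = (\<Sum>i\<le>d. monom (monom (coeff f i) i) (d - i))"

lemma coeff2_homogenize: "coeff2 (homogenize d f) i j = (if i + j = d then coeff f i else 0)"
proof -
  have "coeff2 (homogenize d f) i j = (\<Sum>k\<le>d. if k = i then (if i + j = d then coeff f i else 0) else 0)"
    unfolding homogenize_def coeff2_sum by (intro sum.cong) (auto simp: coeff2_def)
  also have "\<dots> = (if i + j = d then coeff f i else 0)" by simp
  finally show ?thesis .
qed

lemma homogeneous2_homogenize: "homogeneous2 d (homogenize d f)"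
  by (simp add: homogeneous2_def coeff2_homogenize)

lemma poly_homogenize_1:
  assumes "\<forall>k>d. coeff f k = 0"
  shows "poly (homogenize d f) 1 = f"
proof -
  have "degree f \<le> d" using assms by (simp add: degree_le)
  have "poly (homogenize d f) 1 = (\<Sum>i\<le>d. monom (coeff f i) i)"
    by (simp add: homogenize_def poly_sum poly_monom)
  also have "\<dots> = f" using \<open>degree f \<le> d\<close> by (rule poly_as_sum_of_monoms')
  finally show ?thesis .
qed

text \<open>In a form of degree d the exponent of the first variable determines the other one, so
  setting the second variable to 1 merges no coefficients.\<close>

lemma homogeneous2_dehomogenize:
  assumes "homogeneous2 d p"
  shows "p = homogenize d (poly p 1)" "\<forall>k>d. coeff (poly p 1) k = 0"
proof -
  define f where "f = (\<Sum>i\<le>d. monom (coeff2 p i (d - i)) i)"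
  have f: "coeff f i = (if i \<le> d then coeff2 p i (d - i) else 0)" for i
    by (simp add: f_def coeff_sum)
  have p: "p = homogenize d f"
    using assms by (intro poly2_eqI) (auto simp: coeff2_homogenize f homogeneous2_def)
  have "poly p 1 = f" unfolding p by (intro poly_homogenize_1) (simp add: f)
  then show "p = homogenize d (poly p 1)" "\<forall>k>d. coeff (poly p 1) k = 0" using p f by auto
qed

lemma eval2_homogeneous:
  assumes "comm_ring_hom \<phi>" "homogeneous2 d p"
  shows "eval2 \<phi> p x y = hform d (map_poly \<phi> (poly p 1)) x y"
proof -
  interpret \<phi>: comm_ring_hom \<phi> by fact
  interpret e: comm_ring_hom "\<lambda>p. eval2 \<phi> p x y" by (rule comm_ring_hom_eval2[OF assms(1)])
  interpret e1: comm_ring_hom "\<lambda>p. eval_poly \<phi> p x" by (rule comm_ring_hom_eval_poly[OF assms(1)])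
  have "eval2 \<phi> (homogenize d f) x y = hform d (map_poly \<phi> f) x y" for f
    unfolding homogenize_def hform_def e.hom_sum
    by (simp add: eval2_def e1.eval_poly_monom \<phi>.eval_poly_monom)
  then show ?thesis using homogeneous2_dehomogenize(1)[OF assms(2)] by metis
qed

section \<open>Homogeneous resultants\<close>

lemma hom_resultant_homogeneous:
  assumes "homogeneous2 d p" "p \<noteq> 0" "homogeneous2 e q" "q \<noteq> 0"
  shows "hom_resultant p q = det (sylvester_mat_sub d e (poly p 1) (poly q 1))"
  using assms by (simp add: hom_resultant_def tdegree2_homogeneous)

lemma hom_det_sylvester:
  assumes "comm_ring_hom \<phi>"
  shows "\<phi> (det (sylvester_mat_sub d e p q)) =
    det (sylvester_mat_sub d e (map_poly \<phi> p) (map_poly \<phi> q))"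
proof -
  interpret comm_ring_hom \<phi> by fact
  show ?thesis by (simp flip: sylvester_mat_sub_map)
qed

lemma hom_resultant_eq_0_imp_common_zero:
  fixes \<phi> :: "'r::comm_ring_1 \<Rightarrow> 'k::alg_closed_field"
  assumes "comm_ring_hom \<phi>" "homogeneous2 d p" "p \<noteq> 0" "homogeneous2 e q" "q \<noteq> 0"
    and "\<phi> (hom_resultant p q) = 0"
  shows "\<exists>x y. (x, y) \<noteq> (0, 0) \<and> eval2 \<phi> p x y = 0 \<and> eval2 \<phi> q x y = 0"
proof -
  interpret comm_ring_hom \<phi> by fact
  show ?thesis
    unfolding eval2_homogeneous[OF assms(1,2)] eval2_homogeneous[OF assms(1,4)]
    using assms(6) homogeneous2_dehomogenize(2)[OF assms(2)] homogeneous2_dehomogenize(2)[OF assms(4)]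
    by (intro det_sylvester_eq_0_imp_common_zero)
      (auto simp: hom_resultant_homogeneous[OF assms(2-5)] hom_det_sylvester[OF assms(1)])
qed

lemma hom_resultant_common_zero:
  fixes \<phi> :: "'r::comm_ring_1 \<Rightarrow> 's::idom"
  assumes "comm_ring_hom \<phi>" "homogeneous2 d p" "p \<noteq> 0" "homogeneous2 e q" "q \<noteq> 0"
    and "(x, y) \<noteq> (0, 0)" "eval2 \<phi> p x y = 0" "eval2 \<phi> q x y = 0" "d + e > 0"
  shows "\<phi> (hom_resultant p q) = 0"
proof -
  interpret comm_ring_hom \<phi> by fact
  have "det (sylvester_mat_sub d e (map_poly \<phi> (poly p 1)) (map_poly \<phi> (poly q 1))) = 0"
    using assms homogeneous2_dehomogenize(2)[OF assms(2)] homogeneous2_dehomogenize(2)[OF assms(4)]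
    by (intro det_sylvester_common_zero[of _ _ _ _ x y])
      (auto simp: eval2_homogeneous[OF assms(1,2)] eval2_homogeneous[OF assms(1,4)])
  then show ?thesis
    by (simp add: hom_resultant_homogeneous[OF assms(2-5)] hom_det_sylvester[OF assms(1)])
qed

lemma homogeneous2_0: "homogeneous2 d 0"
  by (simp add: homogeneous2_def coeff2_def)

lemma homogeneous2_add:
  fixes p q :: "'r::comm_ring_1 poly2"
  shows "homogeneous2 d p \<Longrightarrow> homogeneous2 d q \<Longrightarrow> homogeneous2 d (p + q)"
  using grading.homog_add[OF grading_grad2] by (simp add: homog_grad2)

lemma homogeneous2_mult:
  fixes p q :: "'r::comm_ring_1 poly2"
  shows "homogeneous2 d p \<Longrightarrow> homogeneous2 e q \<Longrightarrow> homogeneous2 (d + e) (p * q)"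
  using grading.homog_mult[OF grading_grad2] by (simp add: homog_grad2)

lemma homogeneous2_eq_0_iff:
  fixes p :: "'r::comm_ring_1 poly2"
  assumes "homogeneous2 d p"
  shows "p = 0 \<longleftrightarrow> poly p 1 = 0"
proof -
  have "homogenize d 0 = (0 :: 'r poly2)" by (simp add: homogenize_def)
  then show ?thesis using homogeneous2_dehomogenize(1)[OF assms] by auto
qed

text \<open>The cofactors of the dehomogenized polynomials are homogenized to degrees e - 1 and d -
  1. The relation then becomes an identity between forms, which may be checked at second variable 1.
  The strict degree bounds later contradict a divisibility.\<close>

lemma hom_resultant_eq_0E:
  fixes p q :: "'r::idom poly2"
  assumes p: "homogeneous2 d p" "p \<noteq> 0" and q: "homogeneous2 e q" "q \<noteq> 0"
    and "hom_resultant p q = 0"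
  obtains U V where "U \<noteq> 0 \<or> V \<noteq> 0" "U * p + V * q = 0"
    "U = 0 \<or> (\<exists>e'<e. homogeneous2 e' U)" "V = 0 \<or> (\<exists>d'<d. homogeneous2 d' V)"
proof -
  have "det (sylvester_mat_sub d e (poly p 1) (poly q 1)) = 0"
    using assms by (simp add: hom_resultant_homogeneous)
  then obtain u v where uv: "u \<noteq> 0 \<or> v \<noteq> 0" "\<forall>k\<ge>e. coeff u k = 0" "\<forall>k\<ge>d. coeff v k = 0"
    "u * poly p 1 + v * poly q 1 = 0"
    by (rule det_sylvester_eq_0E[OF homogeneous2_dehomogenize(2)[OF p(1)]
          homogeneous2_dehomogenize(2)[OF q(1)]])
  have nz: "poly p 1 \<noteq> 0" "poly q 1 \<noteq> 0"
    using p q by (auto simp: homogeneous2_eq_0_iff)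
  \<comment> \<open>In degree 0 the corresponding cofactor is zero, and then so is the other one.
    Positivity makes e - 1 and d - 1 genuine predecessors.\<close>
  have "e > 0"
  proof (rule ccontr)
    assume "\<not> e > 0"
    then have "u = 0" using uv(2) by (simp add: poly_eq_iff)
    then show False using uv(1,4) nz by auto
  qed
  moreover have "d > 0"
  proof (rule ccontr)
    assume "\<not> d > 0"
    then have "v = 0" using uv(3) by (simp add: poly_eq_iff)
    then show False using uv(1,4) nz by auto
  qed
  ultimately obtain d' e' where d': "d = Suc d'" and e': "e = Suc e'"
    by (metis gr0_implies_Suc)
  define U where "U = homogenize e' u"
  define V where "V = homogenize d' v"
  have 1: "poly U 1 = u" "poly V 1 = v"
    unfolding U_def V_def using uv(2,3) by (auto intro!: poly_homogenize_1 simp: d' e')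
  have hom: "homogeneous2 e' U" "homogeneous2 d' V"
    unfolding U_def V_def by (rule homogeneous2_homogenize)+
  have "homogeneous2 (e' + d) (U * p + V * q)"
    using homogeneous2_mult[OF hom(1) p(1)] homogeneous2_mult[OF hom(2) q(1)]
    by (intro homogeneous2_add) (auto simp: d' e' add.commute)
  then have "U * p + V * q = 0" using uv(4) by (simp add: homogeneous2_eq_0_iff 1)
  moreover have "U \<noteq> 0 \<or> V \<noteq> 0" using uv(1) 1 by auto
  ultimately show thesis using that hom d' e' by blast
qed

text \<open>This serves twice: with the degree in t, v for the resultant in s, u, and with the
  degree in w, x, y, z for the resultant in t, v.\<close>

lemma homog_hom_resultant:
  assumes "grading H" "\<And>i j. homog H \<beta> (coeff2 p i j)" "\<And>i j. homog H \<gamma> (coeff2 q i j)"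
  shows "\<exists>N. homog H N (hom_resultant p q)"
proof -
  interpret grading H by fact
  have c: "homog H \<beta> (coeff (poly p 1) k)" if "\<And>i j. homog H \<beta> (coeff2 p i j)" for \<beta> p k
    using that by (auto simp: poly_altdef coeff_sum coeff2_def intro!: homog_sum)
  have "homog H (\<Sum>i<tdegree2 p + tdegree2 q. if i < tdegree2 q then \<beta> else \<gamma>) (hom_resultant p q)"
    unfolding hom_resultant_def
    by (rule homog_det[OF sylvester_mat_sub_carrier])
      (auto simp: sylvester_mat_sub_index intro!: c assms homog_0)
  then show ?thesis by blast
qed

section \<open>Moving planes\<close>

text \<open>Both x A, once A is known to be free of s, u, and each coefficient of a moving plane
  with respect to s, u have this shape.\<close>

definition plane :: "'a::comm_ring_1 poly2 vec \<Rightarrow> 'a poly4 poly2" where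
  "plane \<alpha> = (\<Sum>l<4. const2 (wxyz $ l) * map_poly2 const4 (\<alpha> $ l))"

lemma less4_cases: "l < 4 \<Longrightarrow> (l = 0 \<Longrightarrow> P) \<Longrightarrow> (l = 1 \<Longrightarrow> P) \<Longrightarrow> (l = 2 \<Longrightarrow> P) \<Longrightarrow> (l = 3 \<Longrightarrow> P) \<Longrightarrow> P"
  for l :: nat
  by linarith

lemma dim_wxyz: "dim_vec wxyz = 4"
  by (simp add: wxyz_def)

lemma wxyz_index: "wxyz $ 0 = const2 var1" "wxyz $ Suc 0 = const2 var2" "wxyz $ 2 = var1" "wxyz $ 3 = var2"
  by (simp_all add: wxyz_def vec_of_list_index eval_nat_numeral)

lemma moving_plane_sum:
  assumes "A \<in> carrier_vec 4"
  shows "moving_plane A = (\<Sum>l<4. const4 (wxyz $ l) * map_poly2 (map_poly2 const4) (A $ l))"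
  using assms by (simp add: moving_plane_def scalar_prod_def lessThan_atLeast0 dim_wxyz)

lemma zero_const: "const2 0 = 0" "const4 0 = 0" "map_poly2 f 0 = 0"
  by (simp_all add: const2_def const4_def map_poly2_def)

lemma coeff2_plane:
  "coeff2 (plane \<alpha>) i j = (\<Sum>l<4. wxyz $ l * const4 (coeff2 (\<alpha> $ l) i j))"
  by (simp add: plane_def coeff2_sum coeff2_const2_mult coeff2_map_poly2 zero_const)

lemma coeff2_moving_plane:
  assumes "A \<in> carrier_vec 4"
  shows "coeff2 (moving_plane A) i j = plane (map_vec (\<lambda>q. coeff2 q i j) A)"
  using assms unfolding moving_plane_sum[OF assms] plane_def coeff2_sum
  by (intro sum.cong) (auto simp: const4_def coeff2_const2_mult coeff2_map_poly2 zero_const)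

lemma moving_plane_of_tv:
  assumes "A \<in> carrier_vec 4" "\<And>l. l < 4 \<Longrightarrow> A $ l = of_tv (\<alpha> $ l)"
  shows "moving_plane A = const2 (plane \<alpha>)"
proof -
  interpret comm_ring_hom const2 by (rule comm_ring_hom_const2)
  show ?thesis
    unfolding moving_plane_sum[OF assms(1)] plane_def hom_sum
    by (intro sum.cong) (auto simp: assms(2) const4_def hom_mult of_tv_def map_poly2_const2 zero_const)
qed

definition ev :: "'a::comm_ring_1 vec \<Rightarrow> 'a \<Rightarrow> 'a \<Rightarrow> 'a poly4 poly2 \<Rightarrow> 'a" where
  "ev x t v Q = eval2 (\<lambda>q. eval4_vec id q x) Q t v"

lemma comm_ring_hom_ev: "comm_ring_hom (ev x t v)"
  unfolding ev_def by (intro comm_ring_hom_eval2 comm_ring_hom_eval4_vec comm_ring_hom_id)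

lemma eval4_vec_wxyz:
  "l < 4 \<Longrightarrow> eval4_vec id (wxyz $ l) x = x $ l"
  by (erule less4_cases)
    (simp_all add: wxyz_index eval4_vec_def eval4_def eval2_const2 eval2_var comm_ring_hom_eval2 comm_ring_hom_id)

lemma eval4_vec_const4: "eval4_vec id (const4 c) x = c"
  by (simp add: const4_def eval4_vec_def eval4_def eval2_const2 comm_ring_hom_eval2 comm_ring_hom_id)

lemma ev_plane: "ev x t v (plane \<alpha>) = (\<Sum>l<4. x $ l * eval2 id (\<alpha> $ l) t v)"
proof -
  interpret comm_ring_hom "ev x t v" by (rule comm_ring_hom_ev)
  have "(\<lambda>c. eval4_vec id (const4 c) x) = id" by (rule ext) (simp add: eval4_vec_const4)
  then show ?thesis
    unfolding plane_def hom_sum hom_mult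
    by (intro sum.cong) (simp_all add: ev_def eval2_const2 eval2_map_poly2 comm_ring_hom_eval4_vec
        comm_ring_hom_id comm_ring_hom_const4 eval4_vec_wxyz)
qed

lemma ev_moving_plane:
  assumes "A \<in> carrier_vec 4"
  shows "eval2 (ev x t v) (moving_plane A) s u = (\<Sum>l<4. x $ l * eval4 id (A $ l) t v s u)"
proof -
  interpret comm_ring_hom "\<lambda>p. eval2 (ev x t v) p s u"
    by (intro comm_ring_hom_eval2 comm_ring_hom_ev)
  have *: "(\<lambda>c. eval4_vec id (const4 c) x) = id" by (rule ext) (simp add: eval4_vec_const4)
  have "ev x t v (map_poly2 const4 q) = eval2 id q t v" for q
    by (simp add: ev_def eval2_map_poly2 comm_ring_hom_eval4_vec
        comm_ring_hom_id comm_ring_hom_const4 *)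
  moreover have "ev x t v (const2 (wxyz $ l)) = x $ l" if "l < 4" for l
    using that by (simp add: ev_def eval2_const2 comm_ring_hom_eval4_vec comm_ring_hom_id eval4_vec_wxyz)
  moreover have "eval2 (ev x t v) (const4 c) s u = ev x t v (const2 c)" for c
    by (simp add: const4_def eval2_const2 comm_ring_hom_ev)
  ultimately show ?thesis
    unfolding moving_plane_sum[OF assms] hom_sum hom_mult
    by (intro sum.cong) (simp_all add: eval2_map_poly2 comm_ring_hom_ev
        comm_ring_hom_map_poly2 comm_ring_hom_const4 eval4_def)
qed

section \<open>Points of the image\<close>

lemma eval_h_param:
  assumes "l < 4"
  shows "eval4 id (h_param f g $ l) t v s u =
    eval2 id (f $ 0) s u * eval2 id (g $ l) t v + eval2 id (f $ l) s u * eval2 id (g $ 0) t v"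
proof -
  interpret comm_ring_hom "\<lambda>p. eval4 id p t v s u"
    by (intro comm_ring_hom_eval4 comm_ring_hom_id)
  show ?thesis using assms by (simp add: h_param_def hom_add hom_mult eval4_of_su eval4_of_tv)
qed

definition h_point :: "'a::field poly2 vec \<Rightarrow> 'a poly2 vec \<Rightarrow> 'a \<Rightarrow> 'a \<Rightarrow> 'a \<Rightarrow> 'a \<Rightarrow> 'a vec" where
  "h_point f g t v s u = map_vec (\<lambda>p. eval4 id p t v s u) (h_param f g)"

lemma dim_h_param: "dim_vec (h_param f g) = 4"
  by (simp add: h_param_def)

text \<open>Evaluation at the parameters is a ring homomorphism, so it passes through the
  substitution of h. The parameters are arbitrary; s = u = 0 is allowed and will be used.\<close>

lemma follows_imp_ev_eq_0:
  assumes "follows (const2 Q) (h_param f g)"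
  shows "ev (h_point f g t v s u) t v Q = 0"
proof -
  define \<theta> where "\<theta> = (\<lambda>p :: 'a poly4. eval4 id p t v s u)"
  have \<theta>: "comm_ring_hom \<theta>" unfolding \<theta>_def by (intro comm_ring_hom_eval4 comm_ring_hom_id)
  interpret \<theta>: comm_ring_hom \<theta> by fact
  let ?h = "h_param f g"
  have var: "\<theta> (const2 var1) = t" "\<theta> (const2 var2) = v"
    by (simp_all add: \<theta>_def eval4_def eval2_const2 eval2_var comm_ring_hom_eval2 comm_ring_hom_id)
  have const: "(\<lambda>c. \<theta> (const4 c)) = id"
    by (rule ext) (simp add: \<theta>_def eval4_def const4_def eval2_const2 comm_ring_hom_eval2 comm_ring_hom_id)
  have "\<theta> (eval4_vec const4 q ?h) = eval4_vec id q (h_point f g t v s u)" for q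
    unfolding eval4_vec_def eval4_hom[OF comm_ring_hom_const4 \<theta>] const
    by (simp add: h_point_def \<theta>_def dim_h_param)
  moreover have "\<theta> (subst_wxyz (const2 Q) ?h) = eval2 (\<lambda>q. \<theta> (eval4_vec const4 q ?h)) Q t v"
    unfolding subst_wxyz_def eval4_def
    by (simp add: eval2_const2 comm_ring_hom_eval2 comm_ring_hom_eval4_vec comm_ring_hom_const4
        eval2_hom[OF comm_ring_hom_eval4_vec[OF comm_ring_hom_const4] \<theta>] var)
  ultimately show ?thesis using assms by (simp add: follows_def ev_def)
qed

lemma eval_homogeneous4:
  fixes G :: "'k::idom poly4"
  assumes "homogeneous4 d G"
  shows "eval4 id G (c * x1) (c * x2) (c * x3) (c * x4) = c ^ d * eval4 id G x1 x2 x3 x4"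
proof -
  \<comment> \<open>The scaling law passes from a coefficient ring to polynomials over it: \<phi>
    and \<phi>' evaluate the coefficients at the original and at the scaled inner coordinates. Four
    applications, starting with constants, give the claim.\<close>
  have lift: "\<forall>d p. homog (lift_grading 1 H) d p \<longrightarrow>
      eval_poly \<phi>' p (c * x) = c ^ d * eval_poly \<phi> p x"
    if "grading H" "comm_ring_hom \<phi>" "comm_ring_hom \<phi>'"
      and scale: "\<forall>d p. homog H d p \<longrightarrow> \<phi>' p = c ^ d * \<phi> p"
    for H :: "'r::comm_ring_1 \<Rightarrow> 'r poly" and \<phi> \<phi>' :: "'r \<Rightarrow> 'k" and x
  proof (intro allI impI)
    fix d p assume p: "homog (lift_grading 1 H) d p"
    interpret \<phi>: comm_ring_hom \<phi> by fact
    interpret \<phi>': comm_ring_hom \<phi>' by fact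
    have "(c * x) ^ i * \<phi>' (coeff p i) = c ^ d * (x ^ i * \<phi> (coeff p i))" for i
    proof (cases "coeff p i = 0")
      case False
      then have i: "i \<le> d" "homog H (d - i) (coeff p i)"
        using p grading.homog_lift[OF that(1)] by auto
      moreover have "c ^ d = c ^ i * c ^ (d - i)" using \<open>i \<le> d\<close> by (simp flip: power_add)
      ultimately show ?thesis using scale by (simp add: power_mult_distrib)
    qed simp
    then show "eval_poly \<phi>' p (c * x) = c ^ d * eval_poly \<phi> p x"
      by (simp add: eval_poly_as_sum sum_distrib_left)
  qed
  note hom = comm_ring_hom_eval_poly comm_ring_hom_id
  note grad = grading.grading_lift grading_triv
  have "\<forall>d p. homog triv_grading d p \<longrightarrow> id p = c ^ d * (id p :: 'k)"
    by (auto simp: homog_triv)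
  note 1 = lift[OF grad(2) hom(2) hom(2) this, of x1]
  note 2 = lift[OF grad(1)[OF grad(2)] hom(1)[OF hom(2)] hom(1)[OF hom(2)] 1, of x2]
  note 3 = lift[OF grad(1)[OF grad(1)[OF grad(2)]] hom(1)[OF hom(1)[OF hom(2)]]
      hom(1)[OF hom(1)[OF hom(2)]] 2, of x3]
  note 4 = lift[OF grad(1)[OF grad(1)[OF grad(1)[OF grad(2)]]] hom(1)[OF hom(1)[OF hom(1)[OF hom(2)]]]
      hom(1)[OF hom(1)[OF hom(1)[OF hom(2)]]] 3, of x4]
  have "homog grad4 d G" using assms by (simp add: homog_grad4)
  then show ?thesis
    unfolding eval4_def eval2_def grad4_def grad2_def using 4 by blast
qed

lemma eval4_vec_homogeneous4:
  fixes G :: "'k::idom poly4"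
  assumes "homogeneous4 d G" "x \<in> carrier_vec 4"
  shows "eval4_vec id G (c \<cdot>\<^sub>v x) = c ^ d * eval4_vec id G x"
  using assms by (simp add: eval4_vec_def eval_homogeneous4)

text \<open>The zero locus of G is closed and contains the image, hence contains the zero locus of
  F. Since projective points omit the origin, this yields the hypothesis of the affine
  Nullstellensatz only away from it.\<close>

lemma implicit_equation_dvd:
  fixes F G :: "'a::{alg_closed_field, field_char_0} poly4"
  assumes "implicit_equation F (h_param f g)" "homogeneous4 d G"
    and van: "\<And>t v s u. (s, u) \<noteq> (0, 0) \<Longrightarrow> (t, v) \<noteq> (0, 0) \<Longrightarrow> eval4_vec id G (h_point f g t v s u) = 0"
  shows "F dvd G"
proof -
  have F: "irreducible F" "proj_zeros {F} = zariski_closure (image_surface (h_param f g))"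
    using assms(1) by (auto simp: implicit_equation_def)
  have "image_surface (h_param f g) \<subseteq> proj_zeros {G}"
  proof
    fix P assume "P \<in> image_surface (h_param f g)"
    then obtain s u t v where P: "P = proj_point (h_point f g t v s u)" "(s, u) \<noteq> (0, 0)"
      "(t, v) \<noteq> (0, 0)" "h_point f g t v s u \<noteq> 0\<^sub>v 4"
      unfolding image_surface_def h_point_def by blast
    have "h_point f g t v s u \<in> carrier_vec 4"
      by (intro carrier_vecI) (simp add: h_point_def dim_h_param)
    then show "P \<in> proj_zeros {G}"
      using van[OF P(2,3)] P(1,4) unfolding proj_zeros_def by blast
  qed
  moreover have "zariski_closed (proj_zeros {G})"
    unfolding zariski_closed_def using assms(2) by (intro exI[of _ "{G}"]) auto
  ultimately have sub: "proj_zeros {F} \<subseteq> proj_zeros {G}"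
    unfolding F(2) zariski_closure_def by blast
  have van': "eval4_vec id G x = 0" if x: "x \<in> carrier_vec 4" "x \<noteq> 0\<^sub>v 4" "eval4_vec id F x = 0" for x
  proof -
    have "proj_point x \<in> proj_zeros {G}" using sub x by (auto simp: proj_zeros_def)
    then obtain y where y: "proj_point x = proj_point y" "y \<in> carrier_vec 4" "eval4_vec id G y = 0"
      by (auto simp: proj_zeros_def)
    have "x \<in> proj_point x" unfolding proj_point_def by (intro CollectI exI[of _ 1]) auto
    then obtain c where "x = c \<cdot>\<^sub>v y" using y(1) by (auto simp: proj_point_def)
    then show ?thesis using eval4_vec_homogeneous4[OF assms(2) y(2)] y(3) by simp
  qed
  \<comment> \<open>Multiplying by a coordinate forces vanishing at the origin as well.\<close>
  have dvd: "F dvd wxyz $ l * G" if "l < 4" for l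
  proof (rule nullstellensatz4[OF F(1)])
    fix x1 x2 x3 x4 :: 'a
    assume "eval4 id F x1 x2 x3 x4 = 0"
    define x where "x = vec_of_list [x1, x2, x3, x4]"
    have x: "x $ 0 = x1" "x $ 1 = x2" "x $ 2 = x3" "x $ 3 = x4" "x \<in> carrier_vec 4"
      by (auto simp: x_def vec_of_list_index numeral_2_eq_2 numeral_3_eq_3 intro!: carrier_vecI)
    then have vec: "eval4 id P x1 x2 x3 x4 = eval4_vec id P x" for P
      by (simp add: eval4_vec_def)
    interpret comm_ring_hom "\<lambda>p. eval4_vec id p x"
      by (intro comm_ring_hom_eval4_vec comm_ring_hom_id)
    have "x = 0\<^sub>v 4 \<or> eval4_vec id G x = 0"
      using van' x(5) \<open>eval4 id F x1 x2 x3 x4 = 0\<close> vec by metis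
    then show "eval4 id (wxyz $ l * G) x1 x2 x3 x4 = 0"
      unfolding vec hom_mult eval4_vec_wxyz[OF that] using that by auto
  qed
  show ?thesis
  proof (rule ccontr)
    assume n: "\<not> F dvd G"
    \<comment> \<open>The prime F would divide both y and z. Dividing y, it is constant in the outer
      variable z; dividing z, it then divides the coefficient 1.\<close>
    have "prime_elem F" using F(1) by simp
    then have "F dvd wxyz $ 2" "F dvd wxyz $ 3"
      using dvd[of 2] dvd[of 3] n by (auto simp: prime_elem_dvd_mult_iff)
    then have *: "F dvd [:[:0, 1:]:]" "F dvd [:0, 1:]" by (auto simp: wxyz_index var1_def var2_def)
    have "degree F \<le> degree [:[:0, 1 :: 'a poly2:]:]" by (rule dvd_imp_degree_le[OF *(1)]) simp
    then obtain p where p: "F = [:p:]" by (auto elim: degree_eq_zeroE)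
    then have "p dvd coeff [:0, 1:] 1" using *(2) by (simp only: const_poly_dvd_iff)
    then have "p dvd 1" by simp
    then have "F dvd 1" by (simp add: p const_poly_dvd_1)
    then show False using F(1) by (simp add: irreducible_def)
  qed
qed

section \<open>Common zeros of the syzygies\<close>

text \<open>The factor is the linear form \<open>u * var1 - s * var2\<close> vanishing at (s, u).
  For u = 0 it is a multiple of the second variable, and divisibility shows in the dehomogenization
  only as a drop of the degree bound from m to m - 1.\<close>

lemma homogeneous2_linear_factor:
  fixes p :: "'k::field poly2"
  assumes "homogeneous2 m p" "eval2 id p s u = 0" "(s, u) \<noteq> (0, 0)" "m \<ge> 1"
  shows "homogenize 1 [:- s, u:] dvd p"
proof -
  let ?p = "poly p 1"
  have p: "hform m ?p s u = 0" "\<forall>k>m. coeff ?p k = 0"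
    using assms(2) homogeneous2_dehomogenize[OF assms(1)]
    by (simp_all add: eval2_homogeneous[OF comm_ring_hom_id assms(1)] map_poly_id)
  have "\<exists>r. ?p = [:- s, u:] * r \<and> (\<forall>k>m - 1. coeff r k = 0)"
  proof (cases "u = 0")
    case True
    then have s: "s \<noteq> 0" using assms(3) by simp
    have "hform m ?p s u = (\<Sum>k\<le>m. if k = m then coeff ?p k * s ^ k else 0)"
      unfolding hform_def by (intro sum.cong) (auto simp: True power_0_left)
    then have "coeff ?p m = 0" using p(1) s by simp
    then have "\<forall>k>m - 1. coeff ?p k = 0" using p(2) assms(4) by (metis Suc_diff_1 less_one linorder_neqE_nat not_less_eq not_le)
    then show ?thesis using s True by (intro exI[of _ "smult (- 1 / s) ?p"]) auto
  next
    case False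
    have "hform m ?p s u = u ^ m * hform m ?p (s / u) 1"
      unfolding hform_def sum_distrib_left
    proof (intro sum.cong refl)
      fix k assume "k \<in> {..m}"
      then have "u ^ m = u ^ k * u ^ (m - k)" by (simp flip: power_add)
      then show "coeff ?p k * s ^ k * u ^ (m - k) = u ^ m * (coeff ?p k * (s / u) ^ k * 1 ^ (m - k))"
        using False by (simp add: power_divide)
    qed
    then have "poly ?p (s / u) = 0" using p False by (simp add: hform_1)
    then obtain r where r: "?p = [:- (s / u), 1:] * r" by (metis poly_eq_0_iff_dvd dvdE)
    have "[:- (s / u), 1:] = smult (1 / u) [:- s, u:]" using False by simp
    then have eq: "?p = [:- s, u:] * smult (1 / u) r"
      using r by (simp only: mult_smult_left mult_smult_right)
    have "\<forall>k>m - 1. coeff r k = 0"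
    proof (cases "r = 0")
      case False
      then have "degree ?p = Suc (degree r)" unfolding r by (subst degree_mult_eq) auto
      moreover have "degree ?p \<le> m" using p(2) by (simp add: degree_le)
      ultimately show ?thesis by (auto intro!: coeff_eq_0)
    qed simp
    then show ?thesis using eq by (intro exI[of _ "smult (1 / u) r"]) auto
  qed
  then obtain r where r: "?p = [:- s, u:] * r" "\<forall>k>m - 1. coeff r k = 0" by blast
  let ?q = "homogenize 1 [:- s, u:] * homogenize (m - 1) r"
  have "homogeneous2 (1 + (m - 1)) ?q"
    by (intro homogeneous2_mult homogeneous2_homogenize)
  then have q: "homogeneous2 m ?q" using assms(4) by simp
  have "poly (homogenize 1 [:- s, u:]) 1 = [:- s, u:]"
    by (rule poly_homogenize_1) (auto simp: coeff_pCons split: nat.split)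
  then have "poly ?q 1 = ?p" using r by (simp add: poly_homogenize_1)
  then have "?q = p" using homogeneous2_dehomogenize(1) q assms(1) by metis
  then show ?thesis by (metis dvd_triv_left)
qed

text \<open>A common zero yields a common linear factor, which is not a unit because it vanishes at
  that zero.\<close>

lemma gcd_1_imp_no_common_zero:
  fixes f :: "'k::field poly2 vec"
  assumes "f \<in> carrier_vec 4" "\<forall>i<4. homogeneous2 m (f $ i)" "is_gcd 1 (set\<^sub>v f)" "m \<ge> 1"
    and "(s, u) \<noteq> (0, 0)"
  shows "\<exists>i<4. eval2 id (f $ i) s u \<noteq> 0"
proof (rule ccontr)
  assume "\<not> ?thesis"
  then have "homogenize 1 [:- s, u:] dvd f $ i" if "i < 4" for i
    using that assms(2) by (intro homogeneous2_linear_factor[OF _ _ assms(5,4)]) blast+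
  then have "\<forall>p\<in>set\<^sub>v f. homogenize 1 [:- s, u:] dvd p"
    using assms(1) by (auto simp: vec_set_def)
  then have "homogenize 1 [:- s, u:] dvd 1" using assms(3) unfolding Defs.is_gcd_def by blast
  then obtain q where q: "1 = homogenize 1 [:- s, u:] * q" by (elim dvdE)
  interpret comm_ring_hom "\<lambda>p :: 'k poly2. eval2 id p s u"
    by (intro comm_ring_hom_eval2 comm_ring_hom_id)
  have lin: "\<forall>k>1. coeff [:- s, u:] k = 0" by (auto simp: coeff_pCons split: nat.split)
  have "eval2 id (homogenize 1 [:- s, u:]) s u = 0"
    unfolding eval2_homogeneous[OF comm_ring_hom_id homogeneous2_homogenize] poly_homogenize_1[OF lin]
    by (simp add: hform_def map_poly_id)
  then have "eval2 id (1 :: 'k poly2) s u = 0" by (subst q) (simp add: hom_mult)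
  then show False by simp
qed

text \<open>A quotient of two forms of equal degree depends only on the projective point, and a
  nonzero form has finitely many zeros there. The value inserted in \<open>?T\<close> belongs to the
  point u = 0. Division by zero gives 0 on both sides of the comparison.\<close>

lemma finite_ratios_at_zeros:
  fixes p q r :: "'k::field poly2"
  assumes "homogeneous2 m p" "homogeneous2 m q" "homogeneous2 m r" "r \<noteq> 0"
  shows "finite {eval2 id p s u / eval2 id q s u | s u. (s, u) \<noteq> (0, 0) \<and> eval2 id r s u = 0}"
proof -
  have aff: "eval2 id p s u = u ^ m * poly (poly p 1) (s / u)" if "homogeneous2 m p" "u \<noteq> 0" for p :: "'k poly2" and s u
  proof -
    have "eval2 id p s u = hform m (poly p 1) s u"
      by (simp add: eval2_homogeneous[OF comm_ring_hom_id that(1)] map_poly_id)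
    also have "\<dots> = u ^ m * hform m (poly p 1) (s / u) 1"
      unfolding hform_def sum_distrib_left
    proof (intro sum.cong refl)
      fix k assume "k \<in> {..m}"
      then have "u ^ m = u ^ k * u ^ (m - k)" by (simp flip: power_add)
      then show "coeff (poly p 1) k * s ^ k * u ^ (m - k) =
          u ^ m * (coeff (poly p 1) k * (s / u) ^ k * 1 ^ (m - k))"
        using that by (simp add: power_divide)
    qed
    finally show ?thesis using homogeneous2_dehomogenize(2)[OF that(1)] by (simp add: hform_1)
  qed
  have inf: "eval2 id p s 0 = coeff (poly p 1) m * s ^ m" if "homogeneous2 m p" for p :: "'k poly2" and s
  proof -
    have "eval2 id p s 0 = (\<Sum>k\<le>m. if k = m then coeff (poly p 1) k * s ^ k else 0)"
      unfolding eval2_homogeneous[OF comm_ring_hom_id that] hform_def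
      by (intro sum.cong) (auto simp: power_0_left map_poly_id)
    then show ?thesis by simp
  qed
  let ?Z = "{x. poly (poly r 1) x = 0}"
  let ?T = "insert (coeff (poly p 1) m / coeff (poly q 1) m)
    ((\<lambda>x. poly (poly p 1) x / poly (poly q 1) x) ` ?Z)"
  have "finite ?Z"
    using assms(3,4) homogeneous2_eq_0_iff by (intro poly_roots_finite) blast
  then have "finite ?T" by simp
  moreover have "{eval2 id p s u / eval2 id q s u | s u. (s, u) \<noteq> (0, 0) \<and> eval2 id r s u = 0} \<subseteq> ?T"
  proof
    fix w assume "w \<in> {eval2 id p s u / eval2 id q s u | s u. (s, u) \<noteq> (0, 0) \<and> eval2 id r s u = 0}"
    then obtain s u where su: "(s, u) \<noteq> (0, 0)" "eval2 id r s u = 0"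
      and w: "w = eval2 id p s u / eval2 id q s u" by blast
    show "w \<in> ?T"
    proof (cases "u = 0")
      case True
      then show ?thesis using su by (simp add: w inf[OF assms(1)] inf[OF assms(2)])
    next
      case False
      then have "s / u \<in> ?Z" using su(2) aff[OF assms(3)] by simp
      moreover have "w = poly (poly p 1) (s / u) / poly (poly q 1) (s / u)"
        using False by (simp add: w aff[OF assms(1)] aff[OF assms(2)])
      ultimately show ?thesis by blast
    qed
  qed
  ultimately show ?thesis by (rule rev_finite_subset)
qed

lemma sum4: "(\<Sum>l<4. F l) = F 0 + F 1 + F 2 + F 3" for F :: "nat \<Rightarrow> 'b::comm_monoid_add"
  by (simp add: eval_nat_numeral)

lemma syz_basis_carrier:
  assumes "is_syz_basis f a b c" "f \<in> carrier_vec 4"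
  shows "a \<in> carrier_vec 4" "b \<in> carrier_vec 4" "c \<in> carrier_vec 4"
  using assms by (auto simp: is_syz_basis_def syz_def)

lemma syz_basis_decompose:
  assumes "is_syz_basis f a b c" "f \<in> carrier_vec 4" "p \<in> syz f"
  shows "\<exists>\<alpha> \<beta> \<gamma>. \<forall>l<4. p $ l = \<alpha> * a $ l + \<beta> * b $ l + \<gamma> * c $ l"
proof -
  obtain \<alpha> \<beta> \<gamma> where "p = \<alpha> \<cdot>\<^sub>v a + \<beta> \<cdot>\<^sub>v b + \<gamma> \<cdot>\<^sub>v c"
    using assms(1,3) unfolding is_syz_basis_def by blast
  then show ?thesis using syz_basis_carrier[OF assms(1,2)] by (intro exI[of _ \<alpha>] exI[of _ \<beta>] exI[of _ \<gamma>]) auto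
qed

text \<open>A zero basis vector would give the zero syzygy two different representations.\<close>

lemma syz_basis_nonzero:
  fixes f :: "'r::comm_ring_1 vec"
  assumes "is_syz_basis f a b c" "f \<in> carrier_vec 4"
  shows "\<exists>l<4. a $ l \<noteq> 0" "\<exists>l<4. b $ l \<noteq> 0" "\<exists>l<4. c $ l \<noteq> 0"
proof -
  note carrier = syz_basis_carrier[OF assms]
  have "0\<^sub>v 4 \<in> syz f" using assms(2) by (auto simp: syz_def)
  then have uniq: "\<alpha> = \<alpha>' \<and> \<beta> = \<beta>' \<and> \<gamma> = \<gamma>'"
    if "0\<^sub>v 4 = \<alpha> \<cdot>\<^sub>v a + \<beta> \<cdot>\<^sub>v b + \<gamma> \<cdot>\<^sub>v c" "0\<^sub>v 4 = \<alpha>' \<cdot>\<^sub>v a + \<beta>' \<cdot>\<^sub>v b + \<gamma>' \<cdot>\<^sub>v c"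
    for \<alpha> \<alpha>' \<beta> \<beta>' \<gamma> \<gamma>'
    using that assms(1) unfolding is_syz_basis_def by blast
  have zero: "0\<^sub>v 4 = 0 \<cdot>\<^sub>v a + 0 \<cdot>\<^sub>v b + 0 \<cdot>\<^sub>v c" using carrier by (intro eq_vecI) auto
  have *: "(\<forall>l<4. a $ l = 0) \<Longrightarrow> 0\<^sub>v 4 = 1 \<cdot>\<^sub>v a + 0 \<cdot>\<^sub>v b + 0 \<cdot>\<^sub>v c"
    "(\<forall>l<4. b $ l = 0) \<Longrightarrow> 0\<^sub>v 4 = 0 \<cdot>\<^sub>v a + 1 \<cdot>\<^sub>v b + 0 \<cdot>\<^sub>v c"
    "(\<forall>l<4. c $ l = 0) \<Longrightarrow> 0\<^sub>v 4 = 0 \<cdot>\<^sub>v a + 0 \<cdot>\<^sub>v b + 1 \<cdot>\<^sub>v c"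
    using carrier by (intro eq_vecI; auto)+
  show "\<exists>l<4. a $ l \<noteq> 0" "\<exists>l<4. b $ l \<noteq> 0" "\<exists>l<4. c $ l \<noteq> 0"
    using uniq[OF zero *(1)] uniq[OF zero *(2)] uniq[OF zero *(3)] by auto
qed

text \<open>
  The Koszul syzygies \<open>f\<^sub>j e\<^sub>i - f\<^sub>i e\<^sub>j\<close> are combinations of \<open>a, b, c\<close>, so a point orthogonal to
  \<open>a, b, c\<close> at some parameter is proportional to \<open>f\<close> there.
\<close>

lemma orthogonal_syz_basis_imp_proportional:
  fixes f :: "'k::field poly2 vec"
  assumes "is_syz_basis f a b c" "f \<in> carrier_vec 4"
    and "(\<Sum>l<4. y l * eval2 id (a $ l) s u) = 0" "(\<Sum>l<4. y l * eval2 id (b $ l) s u) = 0"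
      "(\<Sum>l<4. y l * eval2 id (c $ l) s u) = 0"
    and "i < 4" "j < 4"
  shows "y i * eval2 id (f $ j) s u = y j * eval2 id (f $ i) s u"
proof (cases "i = j")
  case False
  let ?E = "\<lambda>p. eval2 id p s u"
  interpret E: comm_ring_hom ?E by (intro comm_ring_hom_eval2 comm_ring_hom_id)
  define p where "p = vec 4 (\<lambda>l. if l = i then f $ j else if l = j then - (f $ i) else 0)"
  have "p \<bullet> f = (\<Sum>l<4. (if l = i then f $ j * f $ i else 0) + (if l = j then - (f $ i) * f $ j else 0))"
    using assms(2) False by (simp add: scalar_prod_def p_def lessThan_atLeast0, intro sum.cong) auto
  also have "\<dots> = 0" using assms(6,7) by (simp add: sum.distrib)
  finally have "p \<in> syz f" using assms(2) by (simp add: syz_def p_def)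
  then obtain \<alpha> \<beta> \<gamma> where p: "\<forall>l<4. p $ l = \<alpha> * a $ l + \<beta> * b $ l + \<gamma> * c $ l"
    using syz_basis_decompose[OF assms(1,2)] by blast
  have "(\<Sum>l<4. y l * ?E (p $ l)) = (\<Sum>l<4. ?E \<alpha> * (y l * ?E (a $ l)) +
      ?E \<beta> * (y l * ?E (b $ l)) + ?E \<gamma> * (y l * ?E (c $ l)))"
    using p by (intro sum.cong) (auto simp: E.hom_add E.hom_mult algebra_simps)
  also have "\<dots> = ?E \<alpha> * (\<Sum>l<4. y l * ?E (a $ l)) +
      ?E \<beta> * (\<Sum>l<4. y l * ?E (b $ l)) + ?E \<gamma> * (\<Sum>l<4. y l * ?E (c $ l))"
    by (simp only: sum.distrib sum_distrib_left)
  also have "\<dots> = 0" using assms(3-5) by simp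
  finally have "0 = (\<Sum>l<4. y l * ?E (p $ l))" ..
  also have "\<dots> = (\<Sum>l<4. (if l = i then y l * ?E (f $ j) else 0) + (if l = j then - (y l * ?E (f $ i)) else 0))"
    using False by (intro sum.cong) (auto simp: p_def E.hom_uminus)
  also have "\<dots> = y i * ?E (f $ j) - y j * ?E (f $ i)" using assms(6,7) by (simp add: sum.distrib)
  finally show ?thesis by simp
qed simp

lemma ex_constant_relation:
  fixes f :: "'k::field poly2 vec"
  assumes "f \<in> carrier_vec 4" "dim_span f = 3"
  shows "\<exists>\<kappa>. (\<exists>l<4. \<kappa> l \<noteq> 0) \<and> (\<Sum>l<4. const2 (\<kappa> l) * f $ l) = 0"
proof (rule ccontr)
  assume no: "\<not> ?thesis"
  interpret const2: comm_ring_hom "const2 :: 'k \<Rightarrow> 'k poly2" by (rule comm_ring_hom_const2)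
  interpret vs: vector_space "\<lambda>c p :: 'k poly2. const2 c * p"
    by unfold_locales (simp_all add: const2.hom_add const2.hom_mult algebra_simps)
  have rel: "\<kappa> l = 0" if "(\<Sum>l<4. const2 (\<kappa> l) * f $ l) = 0" "l < 4" for \<kappa> l
    using no that by blast
  \<comment> \<open>The span is taken of a set, so repeated entries must be excluded before
    counting; an equality of two entries is itself a linear relation.\<close>
  have inj: "inj_on (($) f) {..<4}"
  proof (rule inj_onI, rule ccontr)
    fix i j :: nat assume ij: "i \<in> {..<4}" "j \<in> {..<4}" "f $ i = f $ j" "i \<noteq> j"
    let ?\<kappa> = "\<lambda>l. if l = i then 1 else if l = j then - 1 else (0 :: 'k)"
    have "(\<Sum>l<4. const2 (?\<kappa> l) * f $ l) =
        (\<Sum>l<4. (if l = i then f $ i else 0) + (if l = j then - (f $ j) else 0))"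
      using ij(4) by (intro sum.cong) (auto simp: const2.hom_uminus)
    also have "\<dots> = 0" using ij by (simp add: sum.distrib)
    finally have "?\<kappa> i = 0" using ij by (intro rel) auto
    then show False by simp
  qed
  have set: "set\<^sub>v f = ($) f ` {..<4}" using assms(1) by (auto simp: vec_set_def)
  have "vs.independent (set\<^sub>v f)"
  proof
    assume "vs.dependent (set\<^sub>v f)"
    then obtain w where w: "\<exists>p\<in>set\<^sub>v f. w p \<noteq> 0" "(\<Sum>p\<in>set\<^sub>v f. const2 (w p) * p) = 0"
      by (subst (asm) vs.dependent_finite) (auto simp: set)
    have "(\<Sum>l<4. const2 (w (f $ l)) * f $ l) = 0"
      using w(2) unfolding set by (simp add: sum.reindex[OF inj])
    then have "w (f $ l) = 0" if "l < 4" for l using rel[of "\<lambda>l. w (f $ l)"] that by blast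
    then show False using w(1) by (auto simp: set)
  qed
  then have "dim_span f = card (set\<^sub>v f)" unfolding dim_span_def by (rule vs.dim_eq_card_independent)
  also have "\<dots> = 4" unfolding set by (simp add: card_image[OF inj])
  finally show False using assms(2) by simp
qed

lemma eval2_homogeneous_at_0:
  assumes "homogeneous2 d p" "d \<ge> 1"
  shows "eval2 id p 0 0 = 0"
  unfolding eval2_homogeneous[OF comm_ring_hom_id assms(1)] hform_def
  using assms(2) by (intro sum.neutral) (auto simp: power_0_left)

text \<open>
  Among the points with coordinates \<open>1, 0, \<tau>\<close> at three indices where \<open>f\<close> is not constrained by \<open>a\<close>,
  those proportional to some \<open>f(s, u)\<close> have \<open>(s, u)\<close> among the finitely many zeros of the entry of \<open>f\<close>
  at the second index, and \<open>\<tau>\<close> is a ratio of two other entries there.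
\<close>

lemma ex_point_off_cone:
  fixes f :: "'k::{alg_closed_field, field_char_0} poly2 vec"
  assumes f: "f \<in> carrier_vec 4" "\<forall>i<4. homogeneous2 m (f $ i)" "is_gcd 1 (set\<^sub>v f)" "m \<ge> 1"
    and "f $ 0 \<noteq> 0" and basis: "is_syz_basis f a b c" and a: "\<And>l. l < 4 \<Longrightarrow> a $ l = const2 (\<kappa> l)"
  shows "\<exists>y. (\<Sum>l<4. y l * \<kappa> l) = 0 \<and> (\<forall>s u. (s, u) \<noteq> (0, 0) \<longrightarrow>
    (\<Sum>l<4. y l * eval2 id (b $ l) s u) \<noteq> 0 \<or> (\<Sum>l<4. y l * eval2 id (c $ l) s u) \<noteq> 0)"
proof -
  obtain k where k: "k < 4" "\<kappa> k \<noteq> 0"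
    using syz_basis_nonzero(1)[OF basis f(1)] a zero_const(1) by metis
  \<comment> \<open>If all entries of f other than f_k were zero, the syzygy a, whose k-th entry is
    nonzero, would force f_k = 0 as well.\<close>
  have "\<exists>i2<4. i2 \<noteq> k \<and> f $ i2 \<noteq> 0"
  proof (rule ccontr)
    assume n: "\<not> ?thesis"
    have "(\<Sum>l<4. a $ l * f $ l) = 0"
      using basis f(1) by (simp add: is_syz_basis_def syz_def scalar_prod_def lessThan_atLeast0)
    moreover have "(\<Sum>l<4. a $ l * f $ l) = (\<Sum>l<4. if l = k then a $ l * f $ l else 0)"
      using n by (intro sum.cong) auto
    ultimately have "a $ k * f $ k = 0" using k(1) by simp
    moreover have "a $ k \<noteq> 0" using a[OF k(1)] k(2) by (simp add: const2_def)
    ultimately have "f $ k = 0" by simp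
    then show False using n \<open>f $ 0 \<noteq> 0\<close> zero_less_numeral by metis
  qed
  then obtain i2 where i2: "i2 < 4" "i2 \<noteq> k" "f $ i2 \<noteq> 0" by blast
  have "card ({..<4} - {k, i2}) = 2" using k i2 by (simp add: card_Diff_subset)
  then obtain i1 i3 where "{..<4} - {k, i2} = {i1, i3}" "i1 \<noteq> i3" by (auto simp: card_2_iff)
  then have i: "{..<4} = {k, i2, i1, i3}" and dist: "i1 \<noteq> i3" "i1 \<noteq> k" "i1 \<noteq> i2" "i3 \<noteq> k" "i3 \<noteq> i2"
    using k(1) i2(1) by blast+
  have lt: "i1 < 4" "i3 < 4" using i by blast+
  let ?T = "{eval2 id (f $ i3) s u / eval2 id (f $ i1) s u | s u. (s, u) \<noteq> (0, 0) \<and> eval2 id (f $ i2) s u = 0}"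
  have "finite ?T" using f(2) lt i2 by (intro finite_ratios_at_zeros[of m]) auto
  then obtain \<tau> where \<tau>: "\<tau> \<notin> ?T" using ex_new_if_finite[OF infinite_UNIV_char_0] by blast
  \<comment> \<open>The entry at k is solved for from orthogonality to \<kappa>. The entry 0 at
    \<open>i2\<close> forces f to vanish there in any proportional vector.\<close>
  define y where "y = (\<lambda>l. if l = i1 then 1 else if l = i3 then \<tau> else
    if l = k then - (\<kappa> i1 + \<tau> * \<kappa> i3) / \<kappa> k else 0)"
  have y: "y i1 = 1" "y i3 = \<tau>" "y i2 = 0" using dist i2 by (auto simp: y_def)
  have sum0: "(\<Sum>l<4. y l * \<kappa> l) = 0"
    unfolding i using dist i2(2) k(2) by (simp add: y_def)
  moreover have "(\<Sum>l<4. y l * eval2 id (b $ l) s u) \<noteq> 0 \<or> (\<Sum>l<4. y l * eval2 id (c $ l) s u) \<noteq> 0"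
    if su: "(s, u) \<noteq> (0, 0)" for s u
  proof (rule ccontr)
    assume "\<not> ?thesis"
    moreover have "(\<Sum>l<4. y l * eval2 id (a $ l) s u) = (\<Sum>l<4. y l * \<kappa> l)"
      by (intro sum.cong) (auto simp: a eval2_const2 comm_ring_hom_id)
    ultimately have par: "i < 4 \<Longrightarrow> j < 4 \<Longrightarrow> y i * eval2 id (f $ j) s u = y j * eval2 id (f $ i) s u" for i j
      using sum0 by (intro orthogonal_syz_basis_imp_proportional[OF basis f(1)]) auto
    let ?e = "\<lambda>i. eval2 id (f $ i) s u"
    have e: "?e i2 = 0" "?e i3 = \<tau> * ?e i1" "?e k = y k * ?e i1"
      using par[OF lt(1) i2(1)] par[OF lt(1) lt(2)] par[OF lt(1) k(1)] y by auto
    have "?e i1 \<noteq> 0"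
    proof
      assume "?e i1 = 0"
      then have "\<forall>l\<in>{k, i2, i1, i3}. ?e l = 0" using e by simp
      then have "\<forall>l<4. ?e l = 0" unfolding i[symmetric] by blast
      then show False using gcd_1_imp_no_common_zero[OF f su] by blast
    qed
    then have "\<tau> = ?e i3 / ?e i1" using e(2) by simp
    then show False using \<tau> su e(1) by blast
  qed
  ultimately show ?thesis by blast
qed

section \<open>The matrix \<open>N\<close>\<close>

lemma N_mat_mult:
  assumes "x \<in> carrier_vec 4"
  shows "N_mat g *\<^sub>v x \<in> carrier_vec 4"
    "(N_mat g *\<^sub>v x) $ 0 = const4 (1/2) * (of_tv (g $ 0) * x $ 0 - of_tv (g $ 1) * x $ 1 -
       of_tv (g $ 2) * x $ 2 - of_tv (g $ 3) * x $ 3)"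
    "0 < l \<Longrightarrow> l < 4 \<Longrightarrow> (N_mat g *\<^sub>v x) $ l = of_tv (g $ 0) * x $ l"
proof -
  have dim: "dim_row (N_mat g) = 4" "dim_col (N_mat g) = 4"
    by (simp_all add: N_mat_def mat_of_rows_list_def Let_def)
  then show "N_mat g *\<^sub>v x \<in> carrier_vec 4" by (intro carrier_vecI) simp
  have row: "(N_mat g *\<^sub>v x) $ l = (\<Sum>k<4. N_mat g $$ (l, k) * x $ k)" if "l < 4" for l
    using assms that dim by (simp add: scalar_prod_def lessThan_atLeast0)
  show "(N_mat g *\<^sub>v x) $ 0 = const4 (1/2) * (of_tv (g $ 0) * x $ 0 - of_tv (g $ 1) * x $ 1 -
       of_tv (g $ 2) * x $ 2 - of_tv (g $ 3) * x $ 3)"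
    unfolding row[OF zero_less_numeral] sum4
    by (simp add: N_mat_def mat_of_rows_list_def Let_def algebra_simps numeral_2_eq_2 numeral_3_eq_3)
  show "(N_mat g *\<^sub>v x) $ l = of_tv (g $ 0) * x $ l" if "0 < l" "l < 4"
    unfolding row[OF that(2)] sum4 using that by (elim less4_cases)
      (simp_all add: N_mat_def mat_of_rows_list_def Let_def numeral_2_eq_2 numeral_3_eq_3)
qed

text \<open>Here x solves x N = y for row vectors: the first column gives x_0 = 2 y_0 / g_0, and
  column l gives x_l g_0 = y_l + (x_0 / 2) g_l.\<close>

lemma ex_N_mat_dual:
  fixes g :: "'k::field_char_0 poly2 vec"
  assumes "eval2 id (g $ 0) t v \<noteq> 0"
  shows "\<exists>x\<in>carrier_vec 4. \<forall>b\<in>carrier_vec 4. \<forall>s u.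
    (\<Sum>l<4. x $ l * eval4 id ((N_mat g *\<^sub>v map_vec of_su b) $ l) t v s u) =
    (\<Sum>l<4. y l * eval2 id (b $ l) s u)"
proof -
  let ?g = "\<lambda>l. eval2 id (g $ l) t v"
  define z where "z = y 0 / ?g 0"
  define x where "x = vec 4 (\<lambda>l. if l = 0 then 2 * z else (y l + z * ?g l) / ?g 0)"
  have x: "x $ 0 = 2 * z" "\<And>l. 0 < l \<Longrightarrow> l < 4 \<Longrightarrow> x $ l = (y l + z * ?g l) / ?g 0"
    by (simp_all add: x_def)
  have "(\<Sum>l<4. x $ l * eval4 id ((N_mat g *\<^sub>v map_vec of_su b) $ l) t v s u) =
      (\<Sum>l<4. y l * eval2 id (b $ l) s u)" if b: "b \<in> carrier_vec 4" for b s u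
  proof -
    interpret E: comm_ring_hom "\<lambda>p :: 'k poly4. eval4 id p t v s u"
      by (intro comm_ring_hom_eval4 comm_ring_hom_id)
    have half: "eval4 id (const4 c) t v s u = c" for c :: 'k
      by (simp add: eval4_def const4_def eval2_const2 comm_ring_hom_eval2 comm_ring_hom_id)
    have carrier: "map_vec of_su b \<in> carrier_vec 4" using b by simp
    note N = N_mat_mult(2,3)[OF carrier]
    let ?b = "\<lambda>l. eval2 id (b $ l) s u"
    have E0: "eval4 id ((N_mat g *\<^sub>v map_vec of_su b) $ 0) t v s u =
        1/2 * (?g 0 * ?b 0 - ?g 1 * ?b 1 - ?g 2 * ?b 2 - ?g 3 * ?b 3)"
      using b by (simp only: N E.hom_mult E.hom_minus half eval4_of_tv) (simp add: eval4_of_su)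
    have 0: "x $ 0 * eval4 id ((N_mat g *\<^sub>v map_vec of_su b) $ 0) t v s u =
        z * (?g 0 * ?b 0 - ?g 1 * ?b 1 - ?g 2 * ?b 2 - ?g 3 * ?b 3)"
      unfolding E0 x(1) by simp
    have l: "x $ l * eval4 id ((N_mat g *\<^sub>v map_vec of_su b) $ l) t v s u = (y l + z * ?g l) * ?b l"
      if "0 < l" "l < 4" for l
      using b that assms by (simp add: N E.hom_mult eval4_of_tv eval4_of_su x)
    have "y 0 = z * ?g 0" using assms by (simp add: z_def)
    then show ?thesis unfolding sum4 0 using l[of 1] l[of 2] l[of 3] by (simp add: algebra_simps)
  qed
  moreover have "x \<in> carrier_vec 4" by (simp add: x_def)
  ultimately show ?thesis by blast
qed

section \<open>Primitive parts\<close>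

text \<open>The factor d divides the nonzero form at \<open>l0\<close>, so it is homogeneous, and of
  one degree only. Each quotient thus has degree n minus that degree.\<close>

lemma homog_common_factor:
  fixes H :: "'r::idom \<Rightarrow> 'r poly"
  assumes H: "grading H" and eq: "\<And>l. l \<in> I \<Longrightarrow> v l = d * V l" "\<And>l. l \<in> I \<Longrightarrow> homog H n (v l)"
    and nz: "l0 \<in> I" "v l0 \<noteq> 0"
  shows "\<exists>e\<le>n. \<forall>l\<in>I. homog H e (V l)"
proof -
  interpret grading H by fact
  have d: "d \<noteq> 0" using eq(1) nz by auto
  obtain k where k: "k \<le> n" "homog H k d"
    using homog_factors[OF H, of n d "V l0"] eq nz by auto
  have "homog H (n - k) (V l)" if l: "l \<in> I" for l
  proof (cases "V l = 0")
    case False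
    then obtain k' where k': "homog H k' d" "homog H (n - k') (V l)"
      using homog_factors[OF H, of n d "V l"] eq[OF l] d by auto
    then have "k' = k" using homog_unique k(2) d by blast
    then show ?thesis using k' by simp
  qed (simp add: homog_0)
  then show ?thesis by (intro exI[of _ "n - k"]) auto
qed

lemma homogeneous2_const2: "homogeneous2 0 (const2 c)"
  by (simp add: homogeneous2_def coeff2_const2)

lemma homogeneous2_0D:
  assumes "homogeneous2 0 p"
  shows "p = const2 (coeff2 p 0 0)"
  using assms by (intro poly2_eqI) (auto simp: coeff2_const2 homogeneous2_def)

text \<open>The entries of N have degree 0 in s, u and degree n in t, v, so both gradings follow
  from one argument over an abstract H.\<close>

lemma homogeneous_N_mat:
  fixes b g :: "'a::field poly2 vec"
  assumes b: "b \<in> carrier_vec 4" "\<forall>i<4. homogeneous2 \<mu> (b $ i)"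
    and g: "\<forall>i<4. homogeneous2 n (g $ i)" and l: "l < 4"
  shows "homogeneous2 \<mu> ((N_mat g *\<^sub>v map_vec of_su b) $ l)"
    "homog grad2_inner n ((N_mat g *\<^sub>v map_vec of_su b) $ l)"
proof -
  let ?G = "\<lambda>i. of_tv (g $ i)" and ?b = "\<lambda>i. map_vec of_su b $ i"
  have *: "homog H d ((N_mat g *\<^sub>v map_vec of_su b) $ l)"
    if H: "grading H" and c: "homog H 0 (const4 (1/2 :: 'a))"
      and t: "\<And>i j. i < 4 \<Longrightarrow> j < 4 \<Longrightarrow> homog H d (?G i * ?b j)" for H d
  proof -
    interpret grading H by fact
    have minus: "homog H d (p - q)" if "homog H d p" "homog H d q" for p q
      using homog_add[OF that(1) homog_minus[OF that(2)]] by simp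
    have carrier: "map_vec of_su b \<in> carrier_vec 4" using b by simp
    have "homog H (0 + d) (const4 (1/2) * (?G 0 * ?b 0 - ?G 1 * ?b 1 - ?G 2 * ?b 2 - ?G 3 * ?b 3))"
      by (intro homog_mult c minus t) auto
    then show ?thesis
      using t[of 0 l] l N_mat_mult(2,3)[OF carrier] by (cases "l = 0") auto
  qed
  have b': "?b i = map_poly2 const2 (b $ i)" if "i < 4" for i
    using b(1) that by (simp add: of_su_def)
  have su: "homogeneous2 \<mu> (?b i)" if "i < 4" for i
    using b that unfolding b'[OF that] by (simp add: homogeneous2_def coeff2_map_poly2 zero_const) (metis zero_const(1))
  have tv: "homog grad2_inner 0 (?b i)" if "i < 4" for i
    unfolding b'[OF that] homog_grad2_inner by (simp add: coeff2_map_poly2 zero_const homogeneous2_const2)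
  have "homogeneous2 0 (?G i)" for i unfolding of_tv_def by (rule homogeneous2_const2)
  then have 1: "homogeneous2 \<mu> (?G i * ?b j)" if "j < 4" for i j
    using homogeneous2_mult[OF _ su[OF that]] by fastforce
  have "homog grad2_inner n (?G i)" if "i < 4" for i
    using g that by (auto simp: homog_grad2_inner of_tv_def coeff2_const2 homogeneous2_0)
  then have 2: "homog grad2_inner n (?G i * ?b j)" if "i < 4" "j < 4" for i j
    using grading.homog_mult[OF grading_grad2_inner _ tv[OF that(2)]] that by fastforce
  have half: "homogeneous2 0 (const4 (1/2 :: 'a))" "homog grad2_inner 0 (const4 (1/2 :: 'a))"
    by (auto simp: const4_def homogeneous2_const2 homog_grad2_inner coeff2_const2 homogeneous2_0)
  show "homogeneous2 \<mu> ((N_mat g *\<^sub>v map_vec of_su b) $ l)"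
    using *[OF grading_grad2] 1 half(1) by (simp add: homog_grad2)
  show "homog grad2_inner n ((N_mat g *\<^sub>v map_vec of_su b) $ l)"
    using *[OF grading_grad2_inner] 2 half(2) by blast
qed

lemma N_mat_mult_nonzero:
  fixes b g :: "'a::field_char_0 poly2 vec"
  assumes b: "b \<in> carrier_vec 4" "\<exists>l<4. b $ l \<noteq> 0" and g: "g $ 0 \<noteq> 0"
  shows "\<exists>l<4. (N_mat g *\<^sub>v map_vec of_su b) $ l \<noteq> 0"
proof -
  have carrier: "map_vec of_su b \<in> carrier_vec 4" using b(1) by simp
  note N = N_mat_mult(2,3)[OF carrier, where g = g]
  have su: "of_su p \<noteq> 0" if nz: "p \<noteq> 0" for p :: "'a poly2"
  proof -
    obtain i j where "coeff2 p i j \<noteq> 0" by (rule poly2_nonzeroE[OF nz])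
    then have "coeff2 (of_su p) i j \<noteq> 0"
      by (simp add: of_su_def coeff2_map_poly2 zero_const) (simp add: const2_def)
    then show ?thesis by (auto simp: coeff2_def)
  qed
  have tv: "of_tv (g $ 0) \<noteq> 0" using g by (simp add: of_tv_def const2_def)
  show ?thesis
  proof (cases "\<exists>l<4. 0 < l \<and> b $ l \<noteq> 0")
    case True
    then obtain l where "l < 4" "0 < l" "b $ l \<noteq> 0" by blast
    then have "(N_mat g *\<^sub>v map_vec of_su b) $ l \<noteq> 0" using b(1) tv su by (simp add: N)
    then show ?thesis using \<open>l < 4\<close> by blast
  next
    case False
    then have zero: "b $ l = 0" if "0 < l" "l < 4" for l using that by blast
    then have "b $ 0 \<noteq> 0" using b(2) by (metis gr0I)
    moreover have "(N_mat g *\<^sub>v map_vec of_su b) $ 0 = const4 (1/2) * (of_tv (g $ 0) * of_su (b $ 0))"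
      unfolding N(1) using b(1) zero by (simp add: of_su_def zero_const)
    moreover have "const4 (1/2 :: 'a) \<noteq> 0" by (simp add: const4_def const2_def)
    ultimately have "(N_mat g *\<^sub>v map_vec of_su b) $ 0 \<noteq> 0" using tv su by simp
    then show ?thesis using zero_less_numeral by blast
  qed
qed

text \<open>The bound e \<le> \<mu> suffices because the removed gcd is homogeneous too. For \<mu> =
  0 it says that the primitive part is free of s, u.\<close>

lemma primitive_part_homogeneous:
  fixes b g :: "'a::field_char_0 poly2 vec"
  assumes b: "b \<in> carrier_vec 4" "\<exists>l<4. b $ l \<noteq> 0" "\<forall>i<4. homogeneous2 \<mu> (b $ i)"
    and g: "g $ 0 \<noteq> 0" "\<forall>i<4. homogeneous2 n (g $ i)"
    and B: "is_primitive_part B (N_mat g *\<^sub>v map_vec of_su b)"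
  shows "B \<in> carrier_vec 4" "\<exists>l<4. B $ l \<noteq> 0"
    "\<exists>d. \<forall>l<4. (N_mat g *\<^sub>v map_vec of_su b) $ l = d * B $ l"
    "\<exists>e\<le>\<mu>. \<forall>l<4. homogeneous2 e (B $ l)"
    "\<exists>\<beta>. \<forall>l<4. \<forall>i j. homogeneous2 \<beta> (coeff2 (B $ l) i j)"
proof -
  let ?v = "N_mat g *\<^sub>v map_vec of_su b"
  have v: "?v \<in> carrier_vec 4" using b(1) by (intro N_mat_mult(1)) simp
  obtain d where d: "?v = d \<cdot>\<^sub>v B" using B by (auto simp: is_primitive_part_def)
  then show carrier: "B \<in> carrier_vec 4" using v by (metis carrier_vecD carrier_vecI index_smult_vec(2))
  then have eq: "?v $ l = d * B $ l" if "l < 4" for l using that by (simp add: d)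
  then show "\<exists>d. \<forall>l<4. ?v $ l = d * B $ l" by blast
  obtain l0 where l0: "l0 < 4" "?v $ l0 \<noteq> 0" using N_mat_mult_nonzero[OF b(1,2) g(1)] by blast
  then show "\<exists>l<4. B $ l \<noteq> 0" using eq[OF l0(1)] by (metis mult_zero_right)
  note hom = homogeneous_N_mat[OF b(1,3) g(2)]
  show "\<exists>e\<le>\<mu>. \<forall>l<4. homogeneous2 e (B $ l)"
    using homog_common_factor[OF grading_grad2, of "{..<4}" "($) ?v" d "($) B" \<mu> l0] eq l0 hom(1)
    by (auto simp: homog_grad2)
  show "\<exists>\<beta>. \<forall>l<4. \<forall>i j. homogeneous2 \<beta> (coeff2 (B $ l) i j)"
    using homog_common_factor[OF grading_grad2_inner, of "{..<4}" "($) ?v" d "($) B" n l0] eq l0 hom(2)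
    unfolding homog_grad2_inner by blast
qed

section \<open>Homogeneity of moving planes\<close>

lemma homogeneous2_plane:
  assumes "\<forall>l<4. homogeneous2 \<beta> (\<alpha> $ l)"
  shows "homogeneous2 \<beta> (plane \<alpha>)"
  unfolding homogeneous2_def
proof (intro allI impI)
  fix i j assume "coeff2 (plane \<alpha>) i j \<noteq> 0"
  then obtain l where "l < 4" "coeff2 (\<alpha> $ l) i j \<noteq> 0"
    unfolding coeff2_plane by (metis (no_types, lifting) lessThan_iff mult_zero_right sum.neutral zero_const(2))
  then show "i + j = \<beta>" using assms by (auto simp: homogeneous2_def)
qed

text \<open>Evaluation at a unit vector isolates one entry of \<alpha>.\<close>

lemma plane_nonzero:
  fixes \<alpha> :: "'a::comm_ring_1 poly2 vec"
  assumes "l < 4" "\<alpha> $ l \<noteq> 0"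
  shows "plane \<alpha> \<noteq> 0"
proof
  assume "plane \<alpha> = 0"
  obtain i j where ij: "coeff2 (\<alpha> $ l) i j \<noteq> 0"
    using assms(2) by (rule poly2_nonzeroE)
  interpret comm_ring_hom "\<lambda>q :: 'a poly4. eval4_vec id q (unit_vec 4 l)"
    by (intro comm_ring_hom_eval4_vec comm_ring_hom_id)
  have "0 = eval4_vec id (coeff2 (plane \<alpha>) i j) (unit_vec 4 l)"
    using \<open>plane \<alpha> = 0\<close> by (simp add: coeff2_def)
  also have "\<dots> = (\<Sum>k<4. unit_vec 4 l $ k * coeff2 (\<alpha> $ k) i j)"
    unfolding coeff2_plane hom_sum hom_mult eval4_vec_const4
    by (intro sum.cong) (auto simp: eval4_vec_wxyz)
  also have "\<dots> = (\<Sum>k<4. if k = l then coeff2 (\<alpha> $ k) i j else 0)"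
    using assms(1) by (intro sum.cong) (auto simp: unit_vec_def)
  also have "\<dots> = coeff2 (\<alpha> $ l) i j" using assms(1) by simp
  finally show False using ij by simp
qed

lemma coeff2_var:
  "coeff2 (var1 :: 'r::comm_ring_1 poly2) i j = (if i = 1 \<and> j = 0 then 1 else 0)"
  "coeff2 (var2 :: 'r::comm_ring_1 poly2) i j = (if i = 0 \<and> j = 1 then 1 else 0)"
  by (auto simp: coeff2_def var1_def var2_def coeff_pCons split: nat.split)

lemma coeff2_0_1:
  "coeff2 (0 :: 'r::comm_ring_1 poly2) i j = 0"
  "coeff2 (1 :: 'r::comm_ring_1 poly2) i j = (if i = 0 \<and> j = 0 then 1 else 0)"
  by (auto simp: coeff2_def coeff_pCons split: nat.split)

lemma homogeneous4_wxyz: "l < 4 \<Longrightarrow> homogeneous4 1 (wxyz $ l :: 'a::comm_ring_1 poly4)"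
  by (erule less4_cases)
    (auto simp: wxyz_index homogeneous4_def coeff4_def coeff2_const2 coeff2_var coeff2_0_1 split: if_splits)

lemma homogeneous4_coeff2_plane: "homogeneous4 1 (coeff2 (plane \<alpha>) i j)"
proof -
  interpret grading grad4 by (rule grading_grad4)
  have "homog grad4 0 (const4 c)" for c :: 'a
    by (auto simp: homog_grad4 homogeneous4_def coeff4_def const4_def coeff2_const2 coeff2_0_1 split: if_splits)
  then have "homog grad4 (1 + 0) (wxyz $ l * const4 c)" if "l < 4" for l and c :: 'a
    using homogeneous4_wxyz[OF that] by (intro homog_mult) (auto simp: homog_grad4)
  then have "homog grad4 1 (coeff2 (plane \<alpha>) i j)"
    unfolding coeff2_plane by (intro homog_sum) auto
  then show ?thesis by (simp add: homog_grad4)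
qed

lemma moving_plane_homogeneous:
  assumes "B \<in> carrier_vec 4" "\<forall>l<4. homogeneous2 e (B $ l)"
    "\<forall>l<4. \<forall>i j. homogeneous2 \<beta> (coeff2 (B $ l) i j)" "\<exists>l<4. B $ l \<noteq> 0"
  shows "homogeneous2 e (moving_plane B)" "moving_plane B \<noteq> 0"
    "homogeneous2 \<beta> (coeff2 (moving_plane B) i j)"
proof -
  note coeff = coeff2_moving_plane[OF assms(1)]
  show "homogeneous2 e (moving_plane B)"
    unfolding homogeneous2_def
  proof (intro allI impI)
    fix i j assume "coeff2 (moving_plane B) i j \<noteq> 0"
    then have "\<exists>l<4. coeff2 (B $ l) i j \<noteq> 0"
      using assms(1) unfolding coeff plane_def
      by (intro ccontr[where P = "\<exists>l<4. coeff2 (B $ l) i j \<noteq> 0"]) (simp add: zero_const)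
    then show "i + j = e" using assms(2) by (auto simp: homogeneous2_def)
  qed
  show "homogeneous2 \<beta> (coeff2 (moving_plane B) i j)"
    unfolding coeff using assms(1,3) by (intro homogeneous2_plane) auto
  obtain l where l: "l < 4" "B $ l \<noteq> 0" using assms(4) by blast
  obtain i' j' where "coeff2 (B $ l) i' j' \<noteq> 0"
    using l(2) by (rule poly2_nonzeroE)
  then have "coeff2 (moving_plane B) i' j' \<noteq> 0"
    unfolding coeff using l assms(1) by (intro plane_nonzero[OF l(1)]) auto
  then show "moving_plane B \<noteq> 0" by (auto simp: coeff2_def)
qed

section \<open>The implicit equation\<close>

text \<open>P is the restriction of Q to the line through the origin and x, obtained by evaluating
  over K[\<tau>] at the point \<tau> x.\<close>

lemma ex_ev_line:
  fixes Q :: "'k::field poly4 poly2"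
  assumes "x \<in> carrier_vec 4"
  shows "\<exists>P. \<forall>\<tau>. poly P \<tau> = ev (\<tau> \<cdot>\<^sub>v x) t v Q"
proof -
  have c: "comm_ring_hom (\<lambda>a::'k. [:a:])" by (rule comm_ring_hom_const_poly)
  define P where "P = eval2 (\<lambda>q. eval4_vec (\<lambda>a. [:a:]) q (vec 4 (\<lambda>l. [:0, x $ l:]))) Q [:t:] [:v:]"
  have "poly P \<tau> = ev (\<tau> \<cdot>\<^sub>v x) t v Q" for \<tau>
  proof -
    have hom: "comm_ring_hom (\<lambda>p :: 'k poly. poly p \<tau>)" by (rule comm_ring_homI) auto
    have "(\<lambda>a :: 'k. poly [:a:] \<tau>) = id" by auto
    then have "poly (eval4_vec (\<lambda>a. [:a:]) q (vec 4 (\<lambda>l. [:0, x $ l:]))) \<tau> = eval4_vec id q (\<tau> \<cdot>\<^sub>v x)" for q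
      using assms by (simp only: eval4_vec_def eval4_hom[OF c hom]) simp
    then show ?thesis
      by (simp add: P_def ev_def eval2_hom[OF comm_ring_hom_eval4_vec[OF c] hom])
  qed
  then show ?thesis by blast
qed

lemma poly_eq_0_punctured:
  fixes P :: "'k::{idom, ring_char_0} poly"
  assumes "\<And>\<tau>. \<tau> \<noteq> 0 \<Longrightarrow> poly P \<tau> = 0"
  shows "P = 0"
proof -
  have "[:0, 1:] * P = 0" using assms by (intro poly_eq_0_all) auto
  then show ?thesis by simp
qed

section \<open>The resultants attached to the parametrization\<close>

locale translational_surface =
  fixes f g a b c :: "'a::{alg_closed_field, field_char_0} poly2 vec"
    and m n \<mu>1 \<mu>2 \<mu>3 :: nat and A B C :: "'a poly4 vec"
  assumes m: "m \<ge> 1"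
    and f: "f \<in> carrier_vec 4" "\<forall>i<4. homogeneous2 m (f $ i)" "is_gcd 1 (set\<^sub>v f)" "f $ 0 \<noteq> 0"
    and g: "\<forall>i<4. homogeneous2 n (g $ i)" "g $ 0 \<noteq> 0"
    and basis: "is_syz_basis f a b c"
    and a: "\<forall>i<4. homogeneous2 \<mu>1 (a $ i)"
    and b: "\<forall>i<4. homogeneous2 \<mu>2 (b $ i)"
    and c: "\<forall>i<4. homogeneous2 \<mu>3 (c $ i)"
    and \<mu>: "\<mu>1 \<le> \<mu>2" "\<mu>2 \<le> \<mu>3"
    and A: "is_primitive_part A (N_mat g *\<^sub>v map_vec of_su a)"
    and B: "is_primitive_part B (N_mat g *\<^sub>v map_vec of_su b)"
    and C: "is_primitive_part C (N_mat g *\<^sub>v map_vec of_su c)"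
    and dim3: "dim_span f = 3"
begin

lemmas carrier = syz_basis_carrier[OF basis f(1)]
lemmas nonzero = syz_basis_nonzero[OF basis f(1)]
lemmas prim_A = primitive_part_homogeneous[OF carrier(1) nonzero(1) a g(2,1) A]
lemmas prim_B = primitive_part_homogeneous[OF carrier(2) nonzero(2) b g(2,1) B]
lemmas prim_C = primitive_part_homogeneous[OF carrier(3) nonzero(3) c g(2,1) C]

text \<open>A linear relation among the f_i is a nonzero constant syzygy. If all basis degrees were
  positive, every combination of a, b, c would vanish at s = u = 0.\<close>

lemma \<mu>1_eq_0: "\<mu>1 = 0"
proof (rule ccontr)
  assume "\<mu>1 \<noteq> 0"
  then have pos: "\<mu>1 \<ge> 1" "\<mu>2 \<ge> 1" "\<mu>3 \<ge> 1" using \<mu> by auto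
  obtain \<kappa> l where \<kappa>: "l < 4" "\<kappa> l \<noteq> 0" "(\<Sum>l<4. const2 (\<kappa> l) * f $ l) = 0"
    using ex_constant_relation[OF f(1) dim3] by blast
  have "vec 4 (\<lambda>l. const2 (\<kappa> l)) \<in> syz f"
    using f(1) \<kappa>(3) by (simp add: syz_def scalar_prod_def lessThan_atLeast0)
  then obtain \<alpha> \<beta> \<gamma> where "\<forall>l<4. vec 4 (\<lambda>l. const2 (\<kappa> l)) $ l = \<alpha> * a $ l + \<beta> * b $ l + \<gamma> * c $ l"
    using syz_basis_decompose[OF basis f(1)] by blast
  then have eq: "const2 (\<kappa> l) = \<alpha> * a $ l + \<beta> * b $ l + \<gamma> * c $ l" using \<kappa>(1) by simp
  interpret E: comm_ring_hom "\<lambda>p :: 'a poly2. eval2 id p 0 0"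
    by (intro comm_ring_hom_eval2 comm_ring_hom_id)
  have "\<kappa> l = eval2 id (const2 (\<kappa> l)) 0 0" by (simp add: eval2_const2 comm_ring_hom_id)
  also have "\<dots> = 0"
    unfolding eq using \<kappa>(1) a b c
    by (simp add: E.hom_add E.hom_mult eval2_homogeneous_at_0[OF _ pos(1)]
        eval2_homogeneous_at_0[OF _ pos(2)] eval2_homogeneous_at_0[OF _ pos(3)])
  finally show False using \<kappa>(2) by simp
qed

definition \<kappa> :: "nat \<Rightarrow> 'a" where "\<kappa> l = coeff2 (a $ l) 0 0"

lemma a_const: "l < 4 \<Longrightarrow> a $ l = const2 (\<kappa> l)"
  using a \<mu>1_eq_0 by (auto simp: \<kappa>_def intro: homogeneous2_0D)

definition \<alpha> :: "'a poly2 vec" where "\<alpha> = map_vec (\<lambda>p. coeff2 p 0 0) A"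

lemma A_eq: "l < 4 \<Longrightarrow> A $ l = of_tv (\<alpha> $ l)"
  using prim_A(1,4) \<mu>1_eq_0 by (auto simp: \<alpha>_def of_tv_def intro: homogeneous2_0D)

lemma moving_plane_A: "moving_plane A = const2 (plane \<alpha>)"
  using prim_A(1) A_eq by (rule moving_plane_of_tv)

lemma plane_\<alpha>_nonzero: "plane \<alpha> \<noteq> 0"
proof -
  obtain l where l: "l < 4" "A $ l \<noteq> 0" using prim_A(2) by blast
  then have "\<alpha> $ l \<noteq> 0" by (auto simp: A_eq of_tv_def zero_const)
  then show ?thesis using l(1) by (intro plane_nonzero)
qed

lemma plane_\<alpha>_homogeneous: "\<exists>k. homogeneous2 k (plane \<alpha>)"
proof -
  obtain k where "\<forall>l<4. \<forall>i j. homogeneous2 k (coeff2 (A $ l) i j)" using prim_A(5) by blast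
  then have "\<forall>l<4. homogeneous2 k (\<alpha> $ l)" using prim_A(1) by (simp add: \<alpha>_def)
  then show ?thesis using homogeneous2_plane by blast
qed

definition Rsu :: "'a poly4 poly2" where
  "Rsu = hom_resultant (moving_plane B) (moving_plane C)"

lemma Rsu_homogeneous: "\<exists>N. homogeneous2 N Rsu"
proof -
  obtain e \<beta> where B: "\<forall>l<4. homogeneous2 e (B $ l)" "\<forall>l<4. \<forall>i j. homogeneous2 \<beta> (coeff2 (B $ l) i j)"
    using prim_B(4,5) by blast
  obtain e' \<gamma> where C: "\<forall>l<4. homogeneous2 e' (C $ l)" "\<forall>l<4. \<forall>i j. homogeneous2 \<gamma> (coeff2 (C $ l) i j)"
    using prim_C(4,5) by blast
  show ?thesis
    using homog_hom_resultant[OF grading_grad2, of \<beta> "moving_plane B" \<gamma> "moving_plane C"]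
      moving_plane_homogeneous(3)[OF prim_B(1) B prim_B(2)]
      moving_plane_homogeneous(3)[OF prim_C(1) C prim_C(2)]
    by (simp add: homog_grad2 Rsu_def)
qed

text \<open>A common zero of x B and x C is also one of the multiples by the removed gcds. The
  conclusion is stated for N b and N c because \<open>ex_N_mat_dual\<close> concerns these.\<close>

lemma Rsu_eq_0_imp:
  assumes "x \<in> carrier_vec 4" "ev x t v Rsu = 0"
  shows "\<exists>s u. (s, u) \<noteq> (0, 0) \<and>
    (\<Sum>l<4. x $ l * eval4 id ((N_mat g *\<^sub>v map_vec of_su b) $ l) t v s u) = 0 \<and>
    (\<Sum>l<4. x $ l * eval4 id ((N_mat g *\<^sub>v map_vec of_su c) $ l) t v s u) = 0"
proof -
  obtain e \<beta> where B: "\<forall>l<4. homogeneous2 e (B $ l)" "\<forall>l<4. \<forall>i j. homogeneous2 \<beta> (coeff2 (B $ l) i j)"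
    using prim_B(4,5) by blast
  obtain e' \<gamma> where C: "\<forall>l<4. homogeneous2 e' (C $ l)" "\<forall>l<4. \<forall>i j. homogeneous2 \<gamma> (coeff2 (C $ l) i j)"
    using prim_C(4,5) by blast
  obtain d where d: "\<forall>l<4. (N_mat g *\<^sub>v map_vec of_su b) $ l = d * B $ l" using prim_B(3) by blast
  obtain d' where d': "\<forall>l<4. (N_mat g *\<^sub>v map_vec of_su c) $ l = d' * C $ l" using prim_C(3) by blast
  obtain s u where su: "(s, u) \<noteq> (0, 0)" "eval2 (ev x t v) (moving_plane B) s u = 0"
    "eval2 (ev x t v) (moving_plane C) s u = 0"
    using hom_resultant_eq_0_imp_common_zero[OF comm_ring_hom_ev
        moving_plane_homogeneous(1,2)[OF prim_B(1) B prim_B(2)]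
        moving_plane_homogeneous(1,2)[OF prim_C(1) C prim_C(2)]] assms(2) unfolding Rsu_def by blast
  interpret E: comm_ring_hom "\<lambda>p :: 'a poly4. eval4 id p t v s u"
    by (intro comm_ring_hom_eval4 comm_ring_hom_id)
  have scale: "(\<Sum>l<4. x $ l * eval4 id (w $ l) t v s u) = eval4 id d t v s u * (\<Sum>l<4. x $ l * eval4 id (V $ l) t v s u)"
    if "\<forall>l<4. w $ l = d * V $ l" for w V d
    unfolding sum_distrib_left using that by (intro sum.cong) (auto simp: E.hom_mult)
  show ?thesis
    using su scale[OF d] scale[OF d'] ev_moving_plane[OF prim_B(1)] ev_moving_plane[OF prim_C(1)]
    by (intro exI[of _ s] exI[of _ u]) simp
qed

text \<open>Both points are preimages of vectors y under \<open>ex_N_mat_dual\<close>: for the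
  second one y is a unit vector at an index where \<kappa> is nonzero, for the first one y comes
  from \<open>ex_point_off_cone\<close>. Excluding zeros of the resultant at all nonzero multiples
  of x prepares the restriction to a line.\<close>

lemma specialization:
  assumes g0: "eval2 id (g $ 0) t v \<noteq> 0"
  shows "\<exists>x\<in>carrier_vec 4. ev x t v (plane \<alpha>) = 0 \<and> (\<forall>\<tau>. \<tau> \<noteq> 0 \<longrightarrow> ev (\<tau> \<cdot>\<^sub>v x) t v Rsu \<noteq> 0)"
    and "\<exists>x\<in>carrier_vec 4. ev x t v (plane \<alpha>) \<noteq> 0"
proof -
  obtain d where d: "\<forall>l<4. (N_mat g *\<^sub>v map_vec of_su a) $ l = d * A $ l" using prim_A(3) by blast
  have plane: "(\<Sum>l<4. x $ l * eval4 id ((N_mat g *\<^sub>v map_vec of_su a) $ l) t v s u) =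
      eval4 id d t v s u * ev x t v (plane \<alpha>)" for x s u
  proof -
    interpret E: comm_ring_hom "\<lambda>p :: 'a poly4. eval4 id p t v s u"
      by (intro comm_ring_hom_eval4 comm_ring_hom_id)
    show ?thesis
      unfolding ev_plane sum_distrib_left using d
      by (intro sum.cong) (auto simp: E.hom_mult A_eq eval4_of_tv)
  qed
  have dual: "\<exists>x\<in>carrier_vec 4.
      (\<forall>s u. eval4 id d t v s u * ev x t v (plane \<alpha>) = (\<Sum>l<4. y l * \<kappa> l)) \<and>
      (\<forall>s u. (\<Sum>l<4. x $ l * eval4 id ((N_mat g *\<^sub>v map_vec of_su b) $ l) t v s u) =
        (\<Sum>l<4. y l * eval2 id (b $ l) s u)) \<and>
      (\<forall>s u. (\<Sum>l<4. x $ l * eval4 id ((N_mat g *\<^sub>v map_vec of_su c) $ l) t v s u) =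
        (\<Sum>l<4. y l * eval2 id (c $ l) s u))" for y
  proof -
    obtain x where x: "x \<in> carrier_vec 4" "\<forall>b\<in>carrier_vec 4. \<forall>s u.
      (\<Sum>l<4. x $ l * eval4 id ((N_mat g *\<^sub>v map_vec of_su b) $ l) t v s u) =
      (\<Sum>l<4. y l * eval2 id (b $ l) s u)"
      using ex_N_mat_dual[OF g0, of y] by blast
    have "eval4 id d t v s u * ev x t v (plane \<alpha>) = (\<Sum>l<4. y l * \<kappa> l)" for s u
    proof -
      have "eval4 id d t v s u * ev x t v (plane \<alpha>) = (\<Sum>l<4. y l * eval2 id (a $ l) s u)"
        using x(2) carrier(1) plane[of x s u] by simp
      also have "\<dots> = (\<Sum>l<4. y l * \<kappa> l)"
        by (intro sum.cong) (auto simp: a_const eval2_const2 comm_ring_hom_id)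
      finally show ?thesis .
    qed
    then show ?thesis using x carrier(2,3) by blast
  qed
  obtain k where k: "k < 4" "\<kappa> k \<noteq> 0"
    using nonzero(1) a_const zero_const(1) by metis
  obtain x where x: "x \<in> carrier_vec 4" "\<And>s u. eval4 id d t v s u * ev x t v (plane \<alpha>) =
      (\<Sum>l<4. (if l = k then 1 else 0) * \<kappa> l)"
    using dual[of "\<lambda>l. if l = k then 1 else 0"] by blast
  have "(\<Sum>l<4. (if l = k then 1 else 0) * \<kappa> l) = (\<Sum>l<4. if l = k then \<kappa> l else 0)"
    by (intro sum.cong) auto
  then have ne: "eval4 id d t v s u * ev x t v (plane \<alpha>) \<noteq> 0" for s u
    using x(2)[of s u] k by simp
  then show "\<exists>x\<in>carrier_vec 4. ev x t v (plane \<alpha>) \<noteq> 0" using x(1) by (metis mult_zero_right)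
  \<comment> \<open>The product of d with the value of x A is the nonzero constant \<kappa> k, so
    the gcd removed from N a cannot vanish over this (t, v). Dividing by it is then
    harmless.\<close>
  have d_nz: "eval4 id d t v s u \<noteq> 0" for s u using ne[of s u] by auto
  obtain y where y: "(\<Sum>l<4. y l * \<kappa> l) = 0" "\<And>s u. (s, u) \<noteq> (0, 0) \<Longrightarrow>
    (\<Sum>l<4. y l * eval2 id (b $ l) s u) \<noteq> 0 \<or> (\<Sum>l<4. y l * eval2 id (c $ l) s u) \<noteq> 0"
    using ex_point_off_cone[OF f(1-3) m f(4) basis a_const] by blast
  obtain z where z: "z \<in> carrier_vec 4"
      "\<And>s u. eval4 id d t v s u * ev z t v (plane \<alpha>) = (\<Sum>l<4. y l * \<kappa> l)"
      "\<And>s u. (\<Sum>l<4. z $ l * eval4 id ((N_mat g *\<^sub>v map_vec of_su b) $ l) t v s u) =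
        (\<Sum>l<4. y l * eval2 id (b $ l) s u)"
      "\<And>s u. (\<Sum>l<4. z $ l * eval4 id ((N_mat g *\<^sub>v map_vec of_su c) $ l) t v s u) =
        (\<Sum>l<4. y l * eval2 id (c $ l) s u)"
    using dual[of y] by blast
  have "ev z t v (plane \<alpha>) = 0" using z(2)[of 0 0] y(1) d_nz[of 0 0] by simp
  moreover have "ev (\<tau> \<cdot>\<^sub>v z) t v Rsu \<noteq> 0" if "\<tau> \<noteq> 0" for \<tau>
  proof
    assume "ev (\<tau> \<cdot>\<^sub>v z) t v Rsu = 0"
    then obtain s u where su: "(s, u) \<noteq> (0, 0)"
      "(\<Sum>l<4. (\<tau> \<cdot>\<^sub>v z) $ l * eval4 id ((N_mat g *\<^sub>v map_vec of_su b) $ l) t v s u) = 0"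
      "(\<Sum>l<4. (\<tau> \<cdot>\<^sub>v z) $ l * eval4 id ((N_mat g *\<^sub>v map_vec of_su c) $ l) t v s u) = 0"
      using Rsu_eq_0_imp[of "\<tau> \<cdot>\<^sub>v z"] z(1) smult_carrier_vec by blast
    have "(\<Sum>l<4. (\<tau> \<cdot>\<^sub>v z) $ l * F l) = \<tau> * (\<Sum>l<4. z $ l * F l)" for F
      unfolding sum_distrib_left using z(1) by (intro sum.cong) auto
    then show False using su y(2)[OF su(1)] z(3)[of s u] z(4)[of s u] that by simp
  qed
  ultimately show "\<exists>x\<in>carrier_vec 4. ev x t v (plane \<alpha>) = 0 \<and> (\<forall>\<tau>. \<tau> \<noteq> 0 \<longrightarrow> ev (\<tau> \<cdot>\<^sub>v x) t v Rsu \<noteq> 0)"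
    using z(1) by blast
qed

lemma Rsu_nonzero: "Rsu \<noteq> 0"
proof
  assume "Rsu = 0"
  obtain t v where "eval2 id (g $ 0) t v \<noteq> 0" using ex_nonzero_eval2[OF g(2)] by blast
  then obtain x where x: "ev (1 \<cdot>\<^sub>v x) t v Rsu \<noteq> 0" using specialization(1) one_neq_zero by blast
  interpret comm_ring_hom "ev (1 \<cdot>\<^sub>v x) t v" by (rule comm_ring_hom_ev)
  from x hom_zero show False unfolding \<open>Rsu = 0\<close> by blast
qed

text \<open>All f_i have positive degree. Hence a polynomial that follows h vanishes at the origin
  of (w, x, y, z)-space for every (t, v).\<close>

lemma h_point_0: "h_point f g t v 0 0 = 0\<^sub>v 4"
proof (rule eq_vecI)
  fix i assume "i < dim_vec (0\<^sub>v 4 :: 'a vec)"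
  then show "h_point f g t v 0 0 $ i = 0\<^sub>v 4 $ i"
    using f(2) by (simp add: h_point_def dim_h_param eval_h_param eval2_homogeneous_at_0[OF _ m])
qed (simp add: h_point_def dim_h_param)

text \<open>
  At a general \<open>(t, v)\<close>, the plane \<open>x A = 0\<close> contains a line through the origin on which the
  resultant vanishes at most at the origin. If \<open>x A = Q G\<close> with \<open>Q\<close> dividing the resultant, then
  \<open>G\<close> vanishes on this line, hence at the origin, and so does \<open>Q\<close>: but the linear form \<open>x A\<close> is
  not a product of two polynomials vanishing at the origin.
\<close>

lemma not_dvd_plane:
  assumes "Q dvd Rsu" "follows (const2 Q) (h_param f g)"
  shows "\<not> Q dvd plane \<alpha>"
proof
  assume "Q dvd plane \<alpha>"
  then obtain G where G: "plane \<alpha> = Q * G" by (elim dvdE)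
  obtain Q' where Q': "Rsu = Q * Q'" using assms(1) by (elim dvdE)
  obtain t v where tv: "eval2 id (g $ 0) t v \<noteq> 0" using ex_nonzero_eval2[OF g(2)] by blast
  have hom: "ev x t v (p * q) = ev x t v p * ev x t v q" for x p q
  proof -
    interpret comm_ring_hom "ev x t v" by (rule comm_ring_hom_ev)
    show ?thesis by (rule hom_mult)
  qed
  have linear: "ev (\<tau> \<cdot>\<^sub>v x) t v (plane \<alpha>) = \<tau> * ev x t v (plane \<alpha>)" if "x \<in> carrier_vec 4" for \<tau> x
    unfolding ev_plane sum_distrib_left using that by (intro sum.cong) auto
  have origin: "0 \<cdot>\<^sub>v x = 0\<^sub>v 4" if "x \<in> carrier_vec 4" for x :: "'a vec"
    using that by (intro eq_vecI) auto
  obtain x where x: "x \<in> carrier_vec 4" "ev x t v (plane \<alpha>) = 0"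
    "\<And>\<tau>. \<tau> \<noteq> 0 \<Longrightarrow> ev (\<tau> \<cdot>\<^sub>v x) t v Rsu \<noteq> 0"
    using specialization(1)[OF tv] by blast
  obtain P where P: "\<And>\<tau>. poly P \<tau> = ev (\<tau> \<cdot>\<^sub>v x) t v G" using ex_ev_line[OF x(1)] by blast
  have "poly P \<tau> = 0" if "\<tau> \<noteq> 0" for \<tau>
  proof -
    have "ev (\<tau> \<cdot>\<^sub>v x) t v Q * ev (\<tau> \<cdot>\<^sub>v x) t v G = 0"
      using linear[OF x(1), of \<tau>] x(2) by (simp add: G hom)
    moreover have "ev (\<tau> \<cdot>\<^sub>v x) t v Q \<noteq> 0" using x(3)[OF that] by (auto simp: Q' hom)
    ultimately show ?thesis by (simp add: P)
  qed
  then have "P = 0" by (rule poly_eq_0_punctured)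
  then have G0: "ev (0\<^sub>v 4) t v G = 0" using P[of 0] origin[OF x(1)] by simp
  have Q0: "ev (0\<^sub>v 4) t v Q = 0"
    using follows_imp_ev_eq_0[OF assms(2), of t v 0 0] by (simp add: h_point_0)
  obtain y where y: "y \<in> carrier_vec 4" "ev y t v (plane \<alpha>) \<noteq> 0"
    using specialization(2)[OF tv] by blast
  obtain PQ where PQ: "\<And>\<tau>. poly PQ \<tau> = ev (\<tau> \<cdot>\<^sub>v y) t v Q" using ex_ev_line[OF y(1)] by blast
  obtain PG where PG: "\<And>\<tau>. poly PG \<tau> = ev (\<tau> \<cdot>\<^sub>v y) t v G" using ex_ev_line[OF y(1)] by blast
  have "poly PQ 0 = 0" "poly PG 0 = 0" using PQ[of 0] PG[of 0] origin[OF y(1)] Q0 G0 by auto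
  then obtain q r where qr: "PQ = [:0, 1:] * q" "PG = [:0, 1:] * r"
    by (metis poly_eq_0_iff_dvd dvdE minus_zero)
  have "[:0, 1:] * q * r - [:ev y t v (plane \<alpha>):] = 0"
  proof (rule poly_eq_0_punctured)
    fix \<tau> :: 'a assume "\<tau> \<noteq> 0"
    have "poly PQ \<tau> * poly PG \<tau> = \<tau> * ev y t v (plane \<alpha>)"
      using linear[OF y(1), of \<tau>] by (simp add: PQ PG G hom)
    then show "poly ([:0, 1:] * q * r - [:ev y t v (plane \<alpha>):]) \<tau> = 0"
      using \<open>\<tau> \<noteq> 0\<close> by (simp add: qr ac_simps)
  qed
  then have "poly ([:0, 1:] * q * r - [:ev y t v (plane \<alpha>):]) 0 = 0" by (simp only: poly_0)
  then show False using y(2) by simp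
qed

text \<open>The sum equals g_0^2 times the sum of the a_l f_l. In the first term 1/2 cancels the 2
  in h_0 = 2 f_0 g_0, and its mixed products f_0 g_0 g_l a_l cancel against those of the other
  terms.\<close>

lemma h_param_dot_N_mat: "(\<Sum>l<4. h_param f g $ l * (N_mat g *\<^sub>v map_vec of_su a) $ l) = 0"
proof -
  interpret su: comm_ring_hom "of_su :: 'a poly2 \<Rightarrow> 'a poly4"
    unfolding of_su_def[abs_def] by (intro comm_ring_hom_map_poly2 comm_ring_hom_const2)
  interpret c4: comm_ring_hom "const4 :: 'a \<Rightarrow> 'a poly4" by (rule comm_ring_hom_const4)
  have "map_vec of_su a \<in> carrier_vec 4" using carrier(1) by simp
  note N = N_mat_mult(2,3)[OF this, where g = g]
  let ?F = "\<lambda>l. of_su (f $ l)" and ?G = "\<lambda>l. of_tv (g $ l)" and ?a = "\<lambda>l. of_su (a $ l)"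
  have h: "h_param f g $ l = ?F 0 * ?G l + ?F l * ?G 0" if "l < 4" for l
    using that by (simp add: h_param_def)
  have "const4 (1/2) * 2 = const4 (1/2) * const4 (2 :: 'a)"
    using c4.hom_add[of 1 1] by simp
  also have "\<dots> = 1" by (simp flip: c4.hom_mult)
  finally have half: "const4 (1/2) * 2 = (1 :: 'a poly4)" .
  have N0: "h_param f g $ 0 * (N_mat g *\<^sub>v map_vec of_su a) $ 0 =
      ?F 0 * ?G 0 * (?G 0 * ?a 0 - ?G 1 * ?a 1 - ?G 2 * ?a 2 - ?G 3 * ?a 3)"
  proof -
    have "h_param f g $ 0 * (N_mat g *\<^sub>v map_vec of_su a) $ 0 = const4 (1/2) * 2 *
        (?F 0 * ?G 0 * (?G 0 * ?a 0 - ?G 1 * ?a 1 - ?G 2 * ?a 2 - ?G 3 * ?a 3))"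
      using carrier(1) unfolding N(1) h[OF zero_less_numeral] by (simp add: algebra_simps)
    then show ?thesis unfolding half by simp
  qed
  have Nl: "h_param f g $ l * (N_mat g *\<^sub>v map_vec of_su a) $ l =
      (?F 0 * ?G l + ?F l * ?G 0) * (?G 0 * ?a l)" if "0 < l" "l < 4" for l
    using that carrier(1) by (simp add: N h)
  have "(\<Sum>l<4. a $ l * f $ l) = 0"
    using basis f(1) by (simp add: is_syz_basis_def syz_def scalar_prod_def lessThan_atLeast0)
  then have "(\<Sum>l<4. ?a l * ?F l) = 0" using su.hom_zero by (simp flip: su.hom_mult su.hom_sum)
  then have "?G 0 * ?G 0 * (\<Sum>l<4. ?a l * ?F l) = 0" by simp
  then show ?thesis unfolding sum4 N0 using Nl[of 1] Nl[of 2] Nl[of 3] by (simp add: algebra_simps)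
qed

lemma plane_\<alpha>_at_h_point: "ev (h_point f g t v s u) t v (plane \<alpha>) = 0"
proof -
  obtain d where d: "\<forall>l<4. (N_mat g *\<^sub>v map_vec of_su a) $ l = d * A $ l" using prim_A(3) by blast
  have "d \<noteq> 0" using d N_mat_mult_nonzero[OF carrier(1) nonzero(1) g(2)] by auto
  have "d * (\<Sum>l<4. h_param f g $ l * A $ l) = 0"
    unfolding sum_distrib_left h_param_dot_N_mat[symmetric]
    by (intro sum.cong) (auto simp: d)
  then have sum0: "(\<Sum>l<4. h_param f g $ l * A $ l) = 0" using \<open>d \<noteq> 0\<close> by simp
  interpret E: comm_ring_hom "\<lambda>p :: 'a poly4. eval4 id p t v s u"
    by (intro comm_ring_hom_eval4 comm_ring_hom_id)
  have "ev (h_point f g t v s u) t v (plane \<alpha>) = eval4 id (\<Sum>l<4. h_param f g $ l * A $ l) t v s u"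
    unfolding ev_plane E.hom_sum E.hom_mult
    by (intro sum.cong) (auto simp: A_eq eval4_of_tv h_point_def dim_h_param)
  then show ?thesis using sum0 by simp
qed

lemma implicit_equation_dvd_resultant:
  assumes F: "implicit_equation F (h_param f g)" and F1: "irreducible F1" "F1 dvd Rsu"
    "follows (const2 F1) (h_param f g)"
  shows "hom_resultant (plane \<alpha>) F1 \<noteq> 0" "F dvd hom_resultant (plane \<alpha>) F1"
proof -
  have ndvd: "\<not> F1 dvd plane \<alpha>" using F1(2,3) by (rule not_dvd_plane)
  have F1_nz: "F1 \<noteq> 0" using F1(1) by (auto simp: irreducible_def)
  obtain k where k: "homogeneous2 k (plane \<alpha>)" using plane_\<alpha>_homogeneous by blast
  obtain N where N: "homogeneous2 N Rsu" using Rsu_homogeneous by blast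
  obtain Q where Q: "Rsu = F1 * Q" using F1(2) by (elim dvdE)
  obtain e where e: "homogeneous2 e F1"
    using homog_factors[OF grading_grad2, of N F1 Q] N Rsu_nonzero by (auto simp: homog_grad2 Q)
  show "hom_resultant (plane \<alpha>) F1 \<noteq> 0"
  proof
    assume "hom_resultant (plane \<alpha>) F1 = 0"
    then obtain U V where UV: "U \<noteq> 0 \<or> V \<noteq> 0" "U * plane \<alpha> + V * F1 = 0"
      "U = 0 \<or> (\<exists>e'<e. homogeneous2 e' U)"
      by (rule hom_resultant_eq_0E[OF k plane_\<alpha>_nonzero e F1_nz])
    \<comment> \<open>The prime F_1 has to divide U, a form of degree less than e, while F_1 itself
      has degree e. So U = 0, and then V = 0.\<close>
    have "U * plane \<alpha> = F1 * (- V)" using UV(2) by (simp add: algebra_simps eq_neg_iff_add_eq_0)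
    then have "F1 dvd U * plane \<alpha>" by simp
    then have "F1 dvd U" using F1(1) ndvd by (simp add: prime_elem_dvd_mult_iff flip: prime_elem_iff_irreducible)
    then obtain W where W: "U = F1 * W" by (elim dvdE)
    have "U = 0"
    proof (rule ccontr)
      assume "U \<noteq> 0"
      then obtain e' where e': "e' < e" "homogeneous2 e' U" using UV(3) by blast
      then obtain e'' where "e'' \<le> e'" "homogeneous2 e'' F1"
        using homog_factors[OF grading_grad2, of e' F1 W] \<open>U \<noteq> 0\<close> by (auto simp: homog_grad2 W)
      then show False using grading.homog_unique[OF grading_grad2, of e'' F1 e] e F1_nz e'(1)
        by (simp add: homog_grad2)
    qed
    then show False using UV(1,2) F1_nz by simp
  qed
  have plane_coeff: "homogeneous4 1 (coeff2 (plane \<alpha>) i j)" for i j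
    by (rule homogeneous4_coeff2_plane)
  obtain d where "\<forall>i j k l. homogeneous4 d (coeff4 (const2 F1) i j k l)"
    using F1(3) by (auto simp: follows_def)
  then have "homogeneous4 d (coeff4 (const2 F1) i j 0 0)" for i j by blast
  then have F1_coeff: "homogeneous4 d (coeff2 F1 i j)" for i j
    by (simp add: coeff4_def coeff2_const2)
  have F1_van: "ev (h_point f g t v s u) t v F1 = 0" for t v s u
    using F1(3) by (rule follows_imp_ev_eq_0)
  have ev_const2: "ev x t v (const2 q) = eval4_vec id q x" for x t v and q :: "'a poly4"
    by (simp add: ev_def eval2_const2 comm_ring_hom_eval4_vec comm_ring_hom_id)
  \<comment> \<open>If k = e = 0, the resultant would be the empty determinant 1. Then x A and F_1
    lie in K[w,x,y,z] and both vanish on the surface, so F divides both.\<close>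
  have "k + e > 0"
  proof (rule ccontr)
    assume "\<not> k + e > 0"
    then have "k = 0" "e = 0" by auto
    define \<xi> where "\<xi> = coeff2 (plane \<alpha>) 0 0"
    define \<phi> where "\<phi> = coeff2 F1 0 0"
    have \<xi>: "plane \<alpha> = const2 \<xi>" and \<phi>: "F1 = const2 \<phi>"
      using k e \<open>k = 0\<close> \<open>e = 0\<close> by (auto simp: \<xi>_def \<phi>_def intro: homogeneous2_0D)
    have "homogeneous4 1 \<xi>" "homogeneous4 d \<phi>"
      unfolding \<xi>_def \<phi>_def by (rule plane_coeff F1_coeff)+
    moreover have "eval4_vec id \<xi> (h_point f g t v s u) = 0" "eval4_vec id \<phi> (h_point f g t v s u) = 0"
      for t v s u
      using plane_\<alpha>_at_h_point F1_van unfolding \<xi> \<phi> ev_const2 by blast+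
    ultimately have "F dvd \<xi>" "F dvd \<phi>" by (blast intro: implicit_equation_dvd[OF F])+
    from this(2) obtain w where w: "\<phi> = F * w" by (elim dvdE)
    \<comment> \<open>F is a non-unit divisor of the irreducible \<phi>, hence an associate of it;
      so \<phi> divides \<xi>, against \<open>ndvd\<close>.\<close>
    have "irreducible \<phi>" using F1(1) by (simp add: \<phi> const2_def irreducible_const_poly_iff)
    moreover have "\<not> F dvd 1" using F by (auto simp: implicit_equation_def irreducible_def)
    ultimately have "w dvd 1" using w by (auto dest: irreducibleD)
    then have "\<phi> dvd F" unfolding w by (simp add: mult_unit_dvd_iff)
    then have "\<phi> dvd \<xi>" using \<open>F dvd \<xi>\<close> by (rule dvd_trans)
    then obtain q where "\<xi> = \<phi> * q" by (elim dvdE)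
    then have "plane \<alpha> = F1 * const2 q" by (simp add: \<xi> \<phi> const2_def)
    then show False using ndvd by simp
  qed
  obtain N' where "homogeneous4 N' (hom_resultant (plane \<alpha>) F1)"
    using homog_hom_resultant[OF grading_grad4, of 1 "plane \<alpha>" d F1] plane_coeff F1_coeff
    by (auto simp: homog_grad4)
  then show "F dvd hom_resultant (plane \<alpha>) F1"
  proof (rule implicit_equation_dvd[OF F])
    fix t v s u :: 'a assume "(t, v) \<noteq> (0, 0)"
    then show "eval4_vec id (hom_resultant (plane \<alpha>) F1) (h_point f g t v s u) = 0"
      using hom_resultant_common_zero[OF comm_ring_hom_eval4_vec[OF comm_ring_hom_id]
          k plane_\<alpha>_nonzero e F1_nz, of t v "h_point f g t v s u"]
        plane_\<alpha>_at_h_point F1_van \<open>k + e > 0\<close> by (simp add: ev_def)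
  qed
qed

end

theorem theorem4p6:
  fixes f g a b c :: "'a :: {alg_closed_field, field_char_0} poly2 vec"
    and m n \<mu>1 \<mu>2 \<mu>3 :: nat
    and A B C :: "'a poly4 vec"
    and F1 :: "'a poly4 poly2"
    and F :: "'a poly4"
  assumes "m \<ge> 1" and "n \<ge> 1"
    and "f \<in> carrier_vec 4" and "g \<in> carrier_vec 4"
    and "\<forall>i<4. homogeneous2 m (f $ i)" and "\<forall>i<4. homogeneous2 n (g $ i)"
    and "is_gcd 1 (set\<^sub>v f)" and "is_gcd 1 (set\<^sub>v g)"
    and "f $ 0 \<noteq> 0" and "g $ 0 \<noteq> 0"
    and surface: "zariski_dim (zariski_closure (image_surface (h_param f g))) = 2"
    and basis: "is_syz_basis f a b c"
    and "\<forall>i<4. homogeneous2 \<mu>1 (a $ i)"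
    and "\<forall>i<4. homogeneous2 \<mu>2 (b $ i)"
    and "\<forall>i<4. homogeneous2 \<mu>3 (c $ i)"
    and "\<mu>1 \<le> \<mu>2" and "\<mu>2 \<le> \<mu>3" and "\<mu>1 + \<mu>2 + \<mu>3 = m"
    and "is_primitive_part A (N_mat g *\<^sub>v map_vec of_su a)"
    and "is_primitive_part B (N_mat g *\<^sub>v map_vec of_su b)"
    and "is_primitive_part C (N_mat g *\<^sub>v map_vec of_su c)"
    and implicit: "implicit_equation F (h_param f g)"
    and dim3: "dim_span f = 3"
    and "irreducible F1"
    and "F1 dvd hom_resultant (moving_plane B) (moving_plane C)"
    and "follows (const2 F1) (h_param f g)"
  shows "\<exists>xA. moving_plane A = const2 xA \<and>
           hom_resultant xA F1 \<noteq> 0 \<and>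
           (\<exists>E. hom_resultant xA F1 = E * F)"
proof -
  interpret translational_surface f g a b c m n \<mu>1 \<mu>2 \<mu>3 A B C
    by unfold_locales (use assms in blast)+
  have "F1 dvd Rsu" unfolding Rsu_def by fact
  then show ?thesis
    using moving_plane_A implicit_equation_dvd_resultant[OF implicit]
      \<open>irreducible F1\<close> \<open>follows (const2 F1) (h_param f g)\<close>
    by (metis dvdE mult.commute)
qed

end
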